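(* Let $K$ be a global field of characteristic different from $2$, let $\mathfrak{p}$ be a finite non-dyadic place of $K$, and let $a\in K$ be nonzero. Then the length $\ell_{\mathfrak p}(a)$ of $a$ in the completion $K_{\mathfrak p}$ is given by the following procedure (that is, the procedure correctly returns $\ell_{\mathfrak p}(a)$): \begin{itemize} \item if $v_{\mathfrak p}(a)$ is odd and $-1$ is a square in $K_{\mathfrak p}$, then $\ell_{\mathfrak p}(a)=2$; \item if $v_{\mathfrak p}(a)$ is odd and $-1$ is not a square in $K_{\mathfrak p}$, then $\ell_{\mathfrak p}(a)=3$; \item if $v_{\mathfrak p}(a)$ is even and $a$ is a square in $K_{\mathfrak p}$, then $\ell_{\mathfrak p}(a)=1$; \item if $v_{\mathfrak p}(a)$ is even and $a$ is not a square in $K_{\mathfrak p}$, then $\ell_{\mathfrak p}(a)=2$. \end{itemize}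
   Context: A global field of characteristic different from $2$ is either a number field (finite extension of $\mathbb{Q}$) or a finite extension of $\mathbb{F}(X)$ with $\mathbb{F}$ a finite field of characteristic not $2$ (a global function field). A finite place $\mathfrak p$ is dyadic if it divides $2$ and non-dyadic otherwise; in a global function field of characteristic $\neq 2$ every place is regarded as a finite non-dyadic place. $K_{\mathfrak p}$ is the completion of $K$ at $\mathfrak p$, and $v_{\mathfrak p}$ is the normalized $\mathfrak p$-adic valuation (value group $\mathbb{Z}$). The length $\ell_{\mathfrak p}(a)$ of a nonzero element $a$ in $K_{\mathfrak p}$ is the minimal number of summands needed to write $a$ as a sum of squares of elements of $K_{\mathfrak p}$, and is $\infty$ if $a$ is not such a sum. *)

theory Defs
  imports
    "HOL-Algebra.Algebra"
    "HOL-Algebra.Algebraic_Closure_Type"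
    "HOL-Library.Extended_Nat"
begin

section \<open>Global fields\<close>

definition number_field :: "('a, 'b) ring_scheme \<Rightarrow> bool" where
  "number_field K \<longleftrightarrow> field K \<and>
     (\<exists>h \<in> ring_hom (ring_of_type_algebra :: rat ring) K.
        ring.finite_dimension K (h ` UNIV) (carrier K))"

definition global_function_field :: "('a, 'b) ring_scheme \<Rightarrow> bool" where
  "global_function_field K \<longleftrightarrow> field K \<and>
     (\<exists>F t. subfield F K \<and> finite F \<and> t \<in> carrier K \<and>
        (ring.transcendental K over F) t \<and>
        ring.finite_dimension K (generate_field K (insert t F)) (carrier K))"

definition global_field :: "('a, 'b) ring_scheme \<Rightarrow> bool" where
  "global_field K \<longleftrightarrow> number_field K \<or> global_function_field K"

section \<open>Finite places\<close>

text \<open>A finite place of a global field is given by its normalized discrete valuation, with value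
  group \<open>\<int>\<close>; distinct normalized valuations define distinct places. The value of \<open>v\<close> at zero
  (mathematically \<open>\<infinity>\<close>) is irrelevant: every use of \<open>v\<close> below treats zero separately.\<close>

definition finite_place :: "('a, 'b) ring_scheme \<Rightarrow> ('a \<Rightarrow> int) \<Rightarrow> bool" where
  "finite_place K v \<longleftrightarrow>
     (\<forall>x \<in> carrier K - {\<zero>\<^bsub>K\<^esub>}. \<forall>y \<in> carrier K - {\<zero>\<^bsub>K\<^esub>}.
        v (x \<otimes>\<^bsub>K\<^esub> y) = v x + v y \<and>
        (x \<oplus>\<^bsub>K\<^esub> y \<noteq> \<zero>\<^bsub>K\<^esub> \<longrightarrow> v (x \<oplus>\<^bsub>K\<^esub> y) \<ge> min (v x) (v y))) \<and>
     v ` (carrier K - {\<zero>\<^bsub>K\<^esub>}) = UNIV"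

text \<open>The place divides 2 when 2 has positive valuation. This is meant for characteristic different
  from 2; in odd characteristic 2 is a root of unity, so no place is dyadic.\<close>

definition dyadic :: "('a, 'b) ring_scheme \<Rightarrow> ('a \<Rightarrow> int) \<Rightarrow> bool" where
  "dyadic K v \<longleftrightarrow> v (\<one>\<^bsub>K\<^esub> \<oplus>\<^bsub>K\<^esub> \<one>\<^bsub>K\<^esub>) > 0"

section \<open>Completion at a place\<close>

definition val_ge :: "('a, 'b) ring_scheme \<Rightarrow> ('a \<Rightarrow> int) \<Rightarrow> int \<Rightarrow> 'a \<Rightarrow> bool" where
  "val_ge K v N x \<longleftrightarrow> x = \<zero>\<^bsub>K\<^esub> \<or> v x \<ge> N"

definition cauchy_seqs :: "('a, 'b) ring_scheme \<Rightarrow> ('a \<Rightarrow> int) \<Rightarrow> (nat \<Rightarrow> 'a) set" where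
  "cauchy_seqs K v = {s. range s \<subseteq> carrier K \<and>
     (\<forall>N. \<exists>M. \<forall>m\<ge>M. \<forall>n\<ge>M. val_ge K v N (s m \<ominus>\<^bsub>K\<^esub> s n))}"

definition null_seqs :: "('a, 'b) ring_scheme \<Rightarrow> ('a \<Rightarrow> int) \<Rightarrow> (nat \<Rightarrow> 'a) set" where
  "null_seqs K v = {s. range s \<subseteq> carrier K \<and> (\<forall>N. \<exists>M. \<forall>n\<ge>M. val_ge K v N (s n))}"

definition cauchy_ring :: "('a, 'b) ring_scheme \<Rightarrow> ('a \<Rightarrow> int) \<Rightarrow> (nat \<Rightarrow> 'a) ring" where
  "cauchy_ring K v =
     \<lparr>carrier = cauchy_seqs K v,
      monoid.mult = (\<lambda>s t n. s n \<otimes>\<^bsub>K\<^esub> t n),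
      one = (\<lambda>_. \<one>\<^bsub>K\<^esub>),
      ring.zero = (\<lambda>_. \<zero>\<^bsub>K\<^esub>),
      add = (\<lambda>s t n. s n \<oplus>\<^bsub>K\<^esub> t n)\<rparr>"

definition completion :: "('a, 'b) ring_scheme \<Rightarrow> ('a \<Rightarrow> int) \<Rightarrow> (nat \<Rightarrow> 'a) set ring" where
  "completion K v = cauchy_ring K v Quot null_seqs K v"

definition to_completion ::
  "('a, 'b) ring_scheme \<Rightarrow> ('a \<Rightarrow> int) \<Rightarrow> 'a \<Rightarrow> (nat \<Rightarrow> 'a) set" where
  "to_completion K v a = null_seqs K v +>\<^bsub>cauchy_ring K v\<^esub> (\<lambda>_. a)"

section \<open>Squares and length\<close>

definition is_square_in :: "('a, 'b) ring_scheme \<Rightarrow> 'a \<Rightarrow> bool" where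
  "is_square_in R x \<longleftrightarrow> (\<exists>y \<in> carrier R. x = y \<otimes>\<^bsub>R\<^esub> y)"

definition sum_of_squares_in :: "('a, 'b) ring_scheme \<Rightarrow> nat \<Rightarrow> 'a \<Rightarrow> bool" where
  "sum_of_squares_in R n x \<longleftrightarrow>
     (\<exists>f \<in> {..<n} \<rightarrow> carrier R. x = (\<Oplus>\<^bsub>R\<^esub>i\<in>{..<n}. f i \<otimes>\<^bsub>R\<^esub> f i))"

text \<open>The infimum of the empty set in \<^typ>\<open>enat\<close> is \<open>\<infinity>\<close>.\<close>

definition square_length :: "('a, 'b) ring_scheme \<Rightarrow> 'a \<Rightarrow> enat" where
  "square_length R x = (INF n \<in> {n. sum_of_squares_in R n x}. enat n)"

definition local_length :: "('a, 'b) ring_scheme \<Rightarrow> ('a \<Rightarrow> int) \<Rightarrow> 'a \<Rightarrow> enat" where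
  "local_length K v a = square_length (completion K v) (to_completion K v a)"

end

theory Submission
  imports Defs
begin

text \<open>The residue field at the place is algebraic over a finite field: \<open>K\<close> is algebraic over the
  fraction field of a Euclidean ring (the integers, or the polynomials in a suitable element over a
  finite field) on which \<open>v\<close> is nonnegative, and a relation over that fraction field, divided by a
  coefficient of least value, reduces to a nontrivial relation over a finite field. Hence every residue
  lies in a finite field and is a sum of two squares there, by counting. Since \<open>2\<close> is a unit, Newton's
  iteration inside \<open>K\<close> lifts a square root of a unit modulo the place to the completion, so units, in
  particular \<open>-1\<close>, are sums of two squares in the completion. This settles even values, and for odd
  values \<open>a = ((a + 1)/2)\<^sup>2 - ((a - 1)/2)\<^sup>2\<close> gives the upper bounds. Conversely, a square has even
  value, and if \<open>s\<^sup>2 + t\<^sup>2\<close> has odd value then \<open>s\<close> and \<open>t\<close> have equal value and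
  \<open>(s/t)\<^sup>2 + 1\<close> has positive value, so \<open>-1\<close> is a square.\<close>

section \<open>Finite subrings of fields\<close>

lemma (in ring) finite_dimension_imp_finite:
  assumes "finite K" "finite_dimension K E"
  shows "finite E"
proof -
  obtain n where "dimension n K E"
    using assms(2) unfolding finite_dimension_def by blast
  then show ?thesis
    using assms(1)
  proof induction
    case (Suc_dim v E n K)
    have "line_extension K v E \<subseteq> (\<lambda>(k, e). k \<otimes> v \<oplus> e) ` (K \<times> E)"
      by (auto simp: line_extension_mem_iff)
    then show ?case
      using Suc_dim.IH Suc_dim.prems by (meson finite_SigmaI finite_imageI finite_subset)
  qed simp
qed

lemma (in field) square_eq_imp_eq_or_minus:
  assumes "x \<in> carrier R" "y \<in> carrier R" "x \<otimes> x = y \<otimes> y"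
  shows "x = y \<or> x = \<ominus> y"
proof -
  have "(x \<ominus> y) \<otimes> (x \<oplus> y) = x \<otimes> x \<ominus> y \<otimes> y"
    using assms(1,2) by algebra
  also have "\<dots> = \<zero>"
    using assms by simp
  finally have "x \<ominus> y = \<zero> \<or> x \<oplus> y = \<zero>"
    using assms by (simp add: integral_iff)
  then show ?thesis
    using assms by (metis minus_equality r_right_minus_eq a_comm)
qed

text \<open>Squaring is at most two-to-one, and one-to-one over \<open>\<zero>\<close>, so more than half of the
  elements are squares; hence the squares meet their reflection \<open>y \<mapsto> u - y\<close>.\<close>
lemma (in field) sum_of_two_squares_finite_subring:
  assumes "subring S R" "finite S" "u \<in> S"
  shows "\<exists>y\<in>S. \<exists>z\<in>S. u = y \<otimes> y \<oplus> z \<otimes> z"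
proof -
  note S = subringE[OF assms(1)]
  have carr: "x \<in> carrier R" if "x \<in> S" for x
    using S(1) that by blast
  define Q where "Q = (\<lambda>y. y \<otimes> y) ` S"
  have Q: "finite Q" "Q \<subseteq> S" "\<zero> \<in> Q"
    using assms(2) S(2,6) carr by (auto simp: Q_def image_iff intro!: bexI[of _ "\<zero>"])
  have fib: "card {y \<in> S. y \<otimes> y = q} \<le> 2" if "q \<in> Q" for q
  proof -
    obtain y where y: "y \<in> S" "q = y \<otimes> y"
      using \<open>q \<in> Q\<close> unfolding Q_def by blast
    have "{x \<in> S. x \<otimes> x = q} \<subseteq> {y, \<ominus> y}"
      using square_eq_imp_eq_or_minus carr y by blast
    then have "card {x \<in> S. x \<otimes> x = q} \<le> card {y, \<ominus> y}"
      by (intro card_mono) auto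
    also have "\<dots> \<le> 2"
      by (simp add: card_insert_if)
    finally show ?thesis .
  qed
  have fib0: "{y \<in> S. y \<otimes> y = \<zero>} = {\<zero>}"
    using S(2) carr integral by auto
  have "card S = (\<Sum>q\<in>Q. card {y \<in> S. y \<otimes> y = q})"
    using sum.group[OF assms(2) Q(1), of "\<lambda>y. y \<otimes> y" "\<lambda>_. 1::nat"] by (simp add: Q_def)
  also have "\<dots> = 1 + (\<Sum>q\<in>Q - {\<zero>}. card {y \<in> S. y \<otimes> y = q})"
    using Q fib0 by (subst sum.remove[of Q "\<zero>"]) auto
  also have "\<dots> \<le> 1 + (\<Sum>q\<in>Q - {\<zero>}. 2)"
    by (intro add_left_mono sum_mono fib) auto
  also have "\<dots> < 2 * card Q"
  proof -
    have "card Q = Suc (card (Q - {\<zero>}))"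
      using Q by (metis card_Suc_Diff1)
    then show ?thesis by simp
  qed
  finally have less: "card S < 2 * card Q" .
  define Q' where "Q' = (\<lambda>q. u \<ominus> q) ` Q"
  have inj: "inj_on (\<lambda>q. u \<ominus> q) Q"
  proof (rule inj_onI)
    fix p q assume pq: "p \<in> Q" "q \<in> Q" "u \<ominus> p = u \<ominus> q"
    then have "u \<in> carrier R" "p \<in> carrier R" "q \<in> carrier R"
      using carr assms Q by auto
    with pq(3) show "p = q"
      by (metis a_minus_def add.l_cancel add.inv_closed minus_minus)
  qed
  have Q'S: "Q' \<subseteq> S"
    using Q assms(3) S by (auto simp: Q'_def a_minus_def)
  have "Q \<inter> Q' \<noteq> {}"
  proof
    assume "Q \<inter> Q' = {}"
    then have "card (Q \<union> Q') = 2 * card Q"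
      using Q(1) card_image[OF inj] by (simp add: card_Un_disjoint Q'_def)
    moreover have "card (Q \<union> Q') \<le> card S"
      using Q'S Q(2) assms(2) by (intro card_mono) auto
    ultimately show False
      using less by simp
  qed
  then obtain y z where yz: "y \<in> S" "z \<in> S" "y \<otimes> y = u \<ominus> z \<otimes> z"
    by (auto simp: Q_def Q'_def)
  have "u = y \<otimes> y \<oplus> z \<otimes> z"
    unfolding yz(3) using carr[OF assms(3)] carr[OF yz(2)] by algebra
  with yz show ?thesis by blast
qed

section \<open>Discretely valued fields\<close>

locale discrete_valuation = field R for R (structure) +
  fixes v :: "'a \<Rightarrow> int"
  assumes place: "finite_place R v"
begin

abbreviation ord_ge :: "int \<Rightarrow> 'a \<Rightarrow> bool" where
  "ord_ge \<equiv> val_ge R v"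

lemma nonzero_mult: "\<lbrakk>x \<in> carrier R; y \<in> carrier R; x \<noteq> \<zero>; y \<noteq> \<zero>\<rbrakk> \<Longrightarrow> x \<otimes> y \<noteq> \<zero>"
  by (simp add: integral_iff)

lemma v_mult: "\<lbrakk>x \<in> carrier R; y \<in> carrier R; x \<noteq> \<zero>; y \<noteq> \<zero>\<rbrakk> \<Longrightarrow> v (x \<otimes> y) = v x + v y"
  using place unfolding finite_place_def by auto

lemma v_surj: "\<exists>x\<in>carrier R. x \<noteq> \<zero> \<and> v x = n"
proof -
  have "n \<in> v ` (carrier R - {\<zero>})"
    using place unfolding finite_place_def by auto
  then show ?thesis by auto
qed

lemma v_one [simp]: "v \<one> = 0"
  using v_mult[of \<one> \<one>] by simp

lemma v_minus [simp]:
  assumes "x \<in> carrier R"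
  shows "v (\<ominus> x) = v x"
proof (cases "x = \<zero>")
  case False
  have "v (\<ominus> \<one>) = 0"
    using v_mult[of "\<ominus> \<one>" "\<ominus> \<one>"] by (simp add: l_minus)
  moreover have "\<ominus> x = \<ominus> \<one> \<otimes> x"
    using assms by algebra
  ultimately show ?thesis
    using v_mult[of "\<ominus> \<one>" x] assms False by simp
qed simp

lemma inv_nonzero [simp]:
  assumes "x \<in> carrier R" "x \<noteq> \<zero>"
  shows "inv x \<in> carrier R" "inv x \<noteq> \<zero>" "x \<otimes> inv x = \<one>" "inv x \<otimes> x = \<one>"
  using assms field_Units by (auto simp: nonzero_imp_inverse_nonzero)

lemma v_inv:
  assumes "x \<in> carrier R" "x \<noteq> \<zero>"
  shows "v (inv x) = - v x"
  using v_mult[of x "inv x"] assms by simp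

lemma pow_nonzero: "\<lbrakk>x \<in> carrier R; x \<noteq> \<zero>\<rbrakk> \<Longrightarrow> x [^] (n::nat) \<noteq> \<zero>"
  by (induction n) (auto simp: integral_iff)

lemma v_pow: "\<lbrakk>x \<in> carrier R; x \<noteq> \<zero>\<rbrakk> \<Longrightarrow> v (x [^] (n::nat)) = int n * v x"
  by (induction n) (auto simp: v_mult pow_nonzero algebra_simps)

lemma ord_ge_zero [simp]: "ord_ge n \<zero>"
  by (simp add: val_ge_def)

lemma ord_ge_one [simp]: "ord_ge 0 \<one>"
  by (simp add: val_ge_def)

lemma ord_ge_mono: "\<lbrakk>ord_ge m x; n \<le> m\<rbrakk> \<Longrightarrow> ord_ge n x"
  by (auto simp: val_ge_def)

lemma ord_ge_add:
  assumes "x \<in> carrier R" "y \<in> carrier R" "ord_ge n x" "ord_ge n y"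
  shows "ord_ge n (x \<oplus> y)"
proof (cases "x = \<zero> \<or> y = \<zero> \<or> x \<oplus> y = \<zero>")
  case False
  then have "v (x \<oplus> y) \<ge> min (v x) (v y)"
    using assms place unfolding finite_place_def by auto
  then show ?thesis
    using False assms by (auto simp: val_ge_def)
qed (use assms in auto)

lemma ord_ge_minus: "\<lbrakk>x \<in> carrier R; ord_ge n x\<rbrakk> \<Longrightarrow> ord_ge n (\<ominus> x)"
  by (auto simp: val_ge_def)

lemma ord_ge_diff:
  "\<lbrakk>x \<in> carrier R; y \<in> carrier R; ord_ge n x; ord_ge n y\<rbrakk> \<Longrightarrow> ord_ge n (x \<ominus> y)"
  unfolding a_minus_def by (intro ord_ge_add ord_ge_minus) auto

lemma ord_ge_mult:
  "\<lbrakk>x \<in> carrier R; y \<in> carrier R; ord_ge m x; ord_ge n y\<rbrakk> \<Longrightarrow> ord_ge (m + n) (x \<otimes> y)"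
  by (cases "x = \<zero> \<or> y = \<zero>") (auto simp: val_ge_def v_mult)

lemma ord_ge_mult0:
  "\<lbrakk>x \<in> carrier R; y \<in> carrier R; ord_ge 0 x; ord_ge n y\<rbrakk> \<Longrightarrow> ord_ge n (x \<otimes> y)"
  using ord_ge_mult[of x y 0 n] by simp

lemma v_add_eq:
  assumes "x \<in> carrier R" "y \<in> carrier R" "x \<noteq> \<zero>" "ord_ge (v x + 1) y"
  shows "x \<oplus> y \<noteq> \<zero>" "v (x \<oplus> y) = v x"
proof -
  have x: "x = (x \<oplus> y) \<ominus> y"
    using assms by algebra
  have *: "\<not> ord_ge (v x + 1) x"
    using assms by (simp add: val_ge_def)
  then have **: "\<not> ord_ge (v x + 1) (x \<oplus> y)"
    using x ord_ge_diff[of "x \<oplus> y" y "v x + 1"] assms by auto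
  then show nz: "x \<oplus> y \<noteq> \<zero>"
    by auto
  have "ord_ge (v x) (x \<oplus> y)"
    using assms by (intro ord_ge_add) (auto intro: ord_ge_mono simp: val_ge_def)
  with ** nz show "v (x \<oplus> y) = v x"
    by (auto simp: val_ge_def)
qed

lemma v_cong:
  assumes "x \<in> carrier R" "y \<in> carrier R" "x \<noteq> \<zero>" "ord_ge (v x + 1) (x \<ominus> y)"
  shows "y \<noteq> \<zero>" "v y = v x"
proof -
  have y: "x \<oplus> \<ominus> (x \<ominus> y) = y"
    using assms(1,2) by (simp add: a_minus_def minus_add r_neg2)
  have "ord_ge (v x + 1) (\<ominus> (x \<ominus> y))"
    using assms(1,2,4) by (simp add: ord_ge_minus)
  from v_add_eq[OF assms(1) _ assms(3) this] show "y \<noteq> \<zero>" "v y = v x"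
    using assms(1,2) by (simp_all add: y)
qed

definition val_ring :: "'a set" where
  "val_ring = {x \<in> carrier R. ord_ge 0 x}"

definition max_ideal :: "'a set" where
  "max_ideal = {x \<in> carrier R. ord_ge 1 x}"

lemma val_ringD: "x \<in> val_ring \<Longrightarrow> x \<in> carrier R" "x \<in> val_ring \<Longrightarrow> ord_ge 0 x"
  by (auto simp: val_ring_def)

lemma subring_val_ring: "subring val_ring R"
  by (rule subringI) (auto simp: val_ring_def intro: ord_ge_add ord_ge_minus ord_ge_mult0)

abbreviation VR :: "('a, 'b) ring_scheme" where
  "VR \<equiv> R\<lparr>carrier := val_ring\<rparr>"

lemma cring_VR: "cring VR"
  using subcringI'[OF subring_val_ring] subcring_iff[OF subringE(1)[OF subring_val_ring]] by simp

lemma VR_a_inv: "x \<in> val_ring \<Longrightarrow> \<ominus>\<^bsub>VR\<^esub> x = \<ominus> x"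
proof -
  interpret V: cring VR by (rule cring_VR)
  assume x: "x \<in> val_ring"
  have "\<ominus> x \<in> val_ring"
    using x subringE(5)[OF subring_val_ring] by simp
  then show ?thesis
    using x V.minus_equality[of "\<ominus> x" x] val_ringD by (simp add: l_neg)
qed

lemma VR_minus: "\<lbrakk>x \<in> val_ring; y \<in> val_ring\<rbrakk> \<Longrightarrow> x \<ominus>\<^bsub>VR\<^esub> y = x \<ominus> y"
  by (simp add: a_minus_def VR_a_inv)

lemma ideal_max_ideal: "ideal max_ideal VR"
proof (rule idealI)
  interpret V: cring VR by (rule cring_VR)
  show "ring VR" by (rule V.ring_axioms)
  show "subgroup max_ideal (add_monoid VR)"
  proof (rule V.add.subgroupI)
    show sub: "max_ideal \<subseteq> carrier VR"
      by (auto simp: max_ideal_def val_ring_def intro: ord_ge_mono)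
    show "\<ominus>\<^bsub>VR\<^esub> a \<in> max_ideal" if "a \<in> max_ideal" for a
    proof -
      have "a \<in> val_ring"
        using that sub by auto
      from VR_a_inv[OF this] show ?thesis
        using that by (simp add: max_ideal_def ord_ge_minus)
    qed
    show "max_ideal \<noteq> {}"
      using ord_ge_zero by (auto simp: max_ideal_def)
  qed (auto simp: max_ideal_def intro: ord_ge_add)
  fix a x assume "a \<in> max_ideal" "x \<in> carrier VR"
  then show "x \<otimes>\<^bsub>VR\<^esub> a \<in> max_ideal"
    by (auto simp: max_ideal_def val_ring_def intro: ord_ge_mult0)
  then show "a \<otimes>\<^bsub>VR\<^esub> x \<in> max_ideal"
    using \<open>a \<in> max_ideal\<close> \<open>x \<in> carrier VR\<close> by (simp add: max_ideal_def val_ring_def m_comm)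
qed

lemma maximalideal_max_ideal: "maximalideal max_ideal VR"
proof (rule maximalidealI[OF ideal_max_ideal])
  show "carrier VR \<noteq> max_ideal"
  proof -
    have "\<one> \<in> val_ring" "\<one> \<notin> max_ideal"
      by (auto simp: val_ring_def max_ideal_def val_ge_def)
    then show ?thesis by auto
  qed
  fix J assume J: "ideal J VR" "max_ideal \<subseteq> J" "J \<subseteq> carrier VR"
  show "J = max_ideal \<or> J = carrier VR"
  proof (rule ccontr)
    assume "\<not> ?thesis"
    then obtain x where x: "x \<in> J" "x \<notin> max_ideal" "J \<noteq> carrier VR"
      using J by auto
    then have x': "x \<in> carrier R" "x \<noteq> \<zero>" "v x = 0"
      using J by (auto simp: max_ideal_def val_ring_def val_ge_def)
    then have "inv x \<in> val_ring"
      using v_inv[of x] by (simp add: val_ring_def val_ge_def)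
    then have "inv x \<otimes>\<^bsub>VR\<^esub> x \<in> J"
      using ideal.I_l_closed[OF J(1) x(1), of "inv x"] by simp
    then have "\<one>\<^bsub>VR\<^esub> \<in> J"
      using x' by simp
    then show False
      using ideal.one_imp_carrier[OF J(1)] x(3) by simp
  qed
qed

abbreviation residue_field :: "'a set ring" where
  "residue_field \<equiv> VR Quot max_ideal"

abbreviation residue :: "'a \<Rightarrow> 'a set" where
  "residue \<equiv> (+>\<^bsub>VR\<^esub>) max_ideal"

lemma field_residue_field: "field residue_field"
  by (rule maximalideal.quotient_is_field[OF maximalideal_max_ideal cring_VR])

lemma residue_hom: "ring_hom_ring VR residue_field residue"
  by (rule ideal.rcos_ring_hom_ring[OF ideal_max_ideal])

lemma residue_eq_iff:
  assumes "x \<in> val_ring" "y \<in> val_ring"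
  shows "residue x = residue y \<longleftrightarrow> ord_ge 1 (x \<ominus> y)"
  using ring.quotient_eq_iff_same_a_r_cos[OF ring_hom_ring.axioms(1)[OF residue_hom] ideal_max_ideal, of x y]
    assms VR_minus[OF assms] val_ringD by (auto simp: max_ideal_def)

lemma residue_surj: "q \<in> carrier residue_field \<Longrightarrow> \<exists>x\<in>val_ring. q = residue x"
  unfolding FactRing_simps by auto

end

section \<open>Residues of fractions over a Euclidean ring\<close>

context discrete_valuation
begin

definition finite_residues :: "'a set \<Rightarrow> bool" where
  "finite_residues k \<longleftrightarrow>
     (\<exists>T. finite T \<and> T \<subseteq> val_ring \<and> (\<forall>y\<in>k \<inter> val_ring. \<exists>t\<in>T. ord_ge 1 (y \<ominus> t)))"

lemma frac_cross_eq:
  assumes "f \<in> carrier R" "g \<in> carrier R" "f' \<in> carrier R" "g' \<in> carrier R"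
    and "g \<noteq> \<zero>" "g' \<noteq> \<zero>"
  shows "f \<otimes> inv g \<ominus> f' \<otimes> inv g' = (f \<otimes> g' \<ominus> f' \<otimes> g) \<otimes> (inv g \<otimes> inv g')"
proof -
  note c = assms inv_nonzero(1)[OF assms(2,5)] inv_nonzero(1)[OF assms(4,6)]
  have "(f \<otimes> g' \<ominus> f' \<otimes> g) \<otimes> (inv g \<otimes> inv g') =
      (f \<otimes> inv g) \<otimes> (g' \<otimes> inv g') \<ominus> (f' \<otimes> inv g') \<otimes> (g \<otimes> inv g)"
    using c(1-4,7,8) by algebra
  then show ?thesis
    using c by simp
qed

text \<open>\<open>B n\<close> stands for the elements of Euclidean size at most \<open>n\<close>. Dividing by an element \<open>p\<close> of least
  size among those of positive value, every element of \<open>A\<close> of positive value is a multiple of \<open>p\<close>;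
  so a fraction that is integral at the place has a representation whose denominator is a unit there.\<close>
lemma finite_residues_if_euclidean:
  fixes B :: "nat \<Rightarrow> 'a set" and A :: "'a set"
  assumes A: "A = (\<Union>n. B n)" "A \<subseteq> val_ring"
    and fin: "\<And>n. finite (B n)" and B0: "B 0 \<subseteq> {\<zero>}"
    and div: "\<And>n p g. \<lbrakk>p \<in> B (Suc n); p \<notin> B n; g \<in> A\<rbrakk> \<Longrightarrow> \<exists>q\<in>A. \<exists>r\<in>B n. g = p \<otimes> q \<oplus> r"
    and frac: "\<And>y. y \<in> k \<Longrightarrow> \<exists>f\<in>A. \<exists>g\<in>A. g \<noteq> \<zero> \<and> y = f \<otimes> inv g"
    and nontrivial: "\<exists>c\<in>k. c \<noteq> \<zero> \<and> v c > 0"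
  shows "finite_residues k"
proof -
  have carr: "x \<in> carrier R" "x \<noteq> \<zero> \<Longrightarrow> v x \<ge> 0" if "x \<in> A" for x
    using A that by (auto simp: val_ring_def val_ge_def)
  define P where "P n \<longleftrightarrow> (\<exists>p\<in>B n. p \<noteq> \<zero> \<and> v p > 0)" for n
  obtain c where c: "c \<in> k" "c \<noteq> \<zero>" "v c > 0"
    using nontrivial by blast
  obtain f g where fg: "f \<in> A" "g \<in> A" "g \<noteq> \<zero>" "c = f \<otimes> inv g"
    using frac[OF c(1)] by blast
  have "f \<noteq> \<zero>"
    using fg c carr by auto
  then have "v c = v f - v g"
    using fg carr(1) v_mult[of f "inv g"] v_inv[of g] by auto
  then have "v f > 0"
    using c(3) carr(2)[OF fg(2,3)] by linarith
  then have "\<exists>n. P n"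
    using \<open>f \<noteq> \<zero>\<close> fg(1) A(1) by (auto simp: P_def)
  define n where "n = (LEAST n. P n)"
  have Pn: "P n" and min: "\<And>m. m < n \<Longrightarrow> \<not> P m"
    using LeastI_ex[OF \<open>\<exists>n. P n\<close>] not_less_Least by (auto simp: n_def)
  have "n \<noteq> 0"
    using Pn B0 by (metis P_def singletonD subsetD)
  then obtain k' where n: "n = Suc k'"
    using not0_implies_Suc by blast
  obtain p where p: "p \<in> B (Suc k')" "p \<noteq> \<zero>" "v p > 0"
    using Pn by (auto simp: P_def n)
  have notP: "\<not> P k'"
    using min n by simp
  then have pk: "p \<notin> B k'"
    using p by (auto simp: P_def)
  have pA: "p \<in> A"
    using A(1) p(1) by blast
  have dvd: "\<exists>q\<in>A. g = p \<otimes> q" if g: "g \<in> A" "ord_ge 1 g" for g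
  proof -
    obtain q r where qr: "q \<in> A" "r \<in> B k'" "g = p \<otimes> q \<oplus> r"
      using div[OF p(1) pk g(1)] by blast
    have rA: "r \<in> A"
      using qr A by blast
    note cr = carr(1)[OF pA] carr(1)[OF qr(1)] carr(1)[OF rA] carr(1)[OF g(1)]
    have "ord_ge (1 + 0) (p \<otimes> q)"
      using p qr(1) cr A by (intro ord_ge_mult) (auto simp: val_ge_def dest: carr(2))
    moreover have "r = g \<ominus> p \<otimes> q"
      unfolding qr(3) using cr(1-3) by algebra
    ultimately have "ord_ge 1 r"
      using ord_ge_diff[of g "p \<otimes> q" 1] g cr by auto
    then have "r = \<zero>"
      using notP qr(2) by (auto simp: P_def val_ge_def)
    then show ?thesis
      using qr cr by auto
  qed
  have lowest: "\<exists>f'\<in>A. \<exists>g'\<in>A. g' \<noteq> \<zero> \<and> v g' = 0 \<and> f \<otimes> inv g = f' \<otimes> inv g'"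
    if "f \<in> A" "g \<in> A" "f \<noteq> \<zero>" "g \<noteq> \<zero>" "v g \<le> v f" for f g
    using that
  proof (induction "nat (v g)" arbitrary: f g rule: less_induct)
    case less
    note cr = carr(1)[OF less.prems(1)] carr(1)[OF less.prems(2)] carr(1)[OF pA]
    show ?case
    proof (cases "v g = 0")
      case False
      then have g: "v g > 0"
        using carr(2)[OF less.prems(2,4)] by simp
      then obtain f1 g1 where f1: "f1 \<in> A" "f = p \<otimes> f1" and g1: "g1 \<in> A" "g = p \<otimes> g1"
        using dvd[of f] dvd[of g] less.prems by (auto simp: val_ge_def)
      note cr1 = carr(1)[OF f1(1)] carr(1)[OF g1(1)]
      have nz: "f1 \<noteq> \<zero>" "g1 \<noteq> \<zero>"
        using f1 g1 less.prems cr by auto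
      have vs: "v f = v p + v f1" "v g = v p + v g1"
        using f1 g1 nz p cr cr1 by (auto simp: v_mult)
      have "f \<otimes> inv g \<ominus> f1 \<otimes> inv g1 = (f \<otimes> g1 \<ominus> f1 \<otimes> g) \<otimes> (inv g \<otimes> inv g1)"
        using cr cr1 nz less.prems by (intro frac_cross_eq)
      also have "f \<otimes> g1 \<ominus> f1 \<otimes> g = \<zero>"
        unfolding f1 g1 using cr cr1 by algebra
      finally have "f \<otimes> inv g = f1 \<otimes> inv g1"
        using cr cr1 nz less.prems by simp
      moreover have "\<exists>f'\<in>A. \<exists>g'\<in>A. g' \<noteq> \<zero> \<and> v g' = 0 \<and> f1 \<otimes> inv g1 = f' \<otimes> inv g'"
        using f1(1) g1(1) nz vs p(3) g less.prems by (intro less.hyps) auto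
      ultimately show ?thesis by simp
    qed (use less.prems in blast)
  qed
  define T where "T = insert \<zero> ((\<lambda>(r, s). r \<otimes> inv s) ` (B k' \<times> {s \<in> B k'. s \<noteq> \<zero> \<and> v s = 0}))"
  have Bk': "B k' \<subseteq> A"
    using A(1) by blast
  have "finite T"
    using fin by (simp add: T_def)
  moreover have "T \<subseteq> val_ring"
  proof -
    have "r \<otimes> inv s \<in> val_ring" if "r \<in> B k'" "s \<in> B k'" "s \<noteq> \<zero>" "v s = 0" for r s
    proof -
      have "r \<in> val_ring" "s \<in> carrier R"
        using that Bk' A(2) carr by auto
      then show ?thesis
        using that v_inv[of s] ord_ge_mult0[of r "inv s" 0] by (auto simp: val_ring_def val_ge_def)
    qed
    then show ?thesis
      using subringE(2)[OF subring_val_ring] by (auto simp: T_def)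
  qed
  moreover have "\<exists>t\<in>T. ord_ge 1 (y \<ominus> t)" if y: "y \<in> k \<inter> val_ring" for y
  proof (cases "y = \<zero>")
    case True
    then show ?thesis
      by (intro bexI[of _ "\<zero>"]) (auto simp: T_def a_minus_def)
  next
    case False
    obtain f0 g0 where 0: "f0 \<in> A" "g0 \<in> A" "g0 \<noteq> \<zero>" "y = f0 \<otimes> inv g0"
      using frac y by blast
    then have "f0 \<noteq> \<zero>"
      using False carr by auto
    moreover have "v y = v f0 - v g0"
      using 0 \<open>f0 \<noteq> \<zero>\<close> carr(1) v_mult[of f0 "inv g0"] v_inv[of g0] by auto
    then have "v g0 \<le> v f0"
      using False y by (auto simp: val_ring_def val_ge_def)
    ultimately obtain f g where fg: "f \<in> A" "g \<in> A" "g \<noteq> \<zero>" "v g = 0" "y = f \<otimes> inv g"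
      using lowest[OF 0(1,2) _ 0(3)] 0(4) by blast
    obtain q r where qr: "q \<in> A" "r \<in> B k'" "f = p \<otimes> q \<oplus> r"
      using div[OF p(1) pk fg(1)] by blast
    obtain q' s where qs: "q' \<in> A" "s \<in> B k'" "g = p \<otimes> q' \<oplus> s"
      using div[OF p(1) pk fg(2)] by blast
    have rs: "r \<in> A" "s \<in> A"
      using qr qs Bk' by auto
    note cr = carr(1)[OF pA] carr(1)[OF fg(1)] carr(1)[OF fg(2)] carr(1)[OF qr(1)]
      carr(1)[OF qs(1)] carr(1)[OF rs(1)] carr(1)[OF rs(2)]
    have AO: "ord_ge 0 x" if "x \<in> A" for x
      using A(2) that by (auto simp: val_ring_def)
    have p1: "ord_ge 1 p"
      using p by (simp add: val_ge_def)
    have "g \<ominus> s = p \<otimes> q'"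
      unfolding qs(3) using cr(1,5,7) by algebra
    then have "ord_ge (v g + 1) (g \<ominus> s)"
      using ord_ge_mult[OF cr(1,5) p1 AO[OF qs(1)]] fg(4) by simp
    then have s: "s \<noteq> \<zero>" "v s = 0"
      using v_cong[OF cr(3,7) fg(3)] fg(4) by auto
    have ci: "inv g \<in> carrier R" "inv s \<in> carrier R"
      using cr fg s by auto
    have "y \<ominus> r \<otimes> inv s = (f \<otimes> s \<ominus> r \<otimes> g) \<otimes> (inv g \<otimes> inv s)"
      unfolding fg(5) using cr s fg by (intro frac_cross_eq)
    also have "f \<otimes> s \<ominus> r \<otimes> g = p \<otimes> (q \<otimes> s \<ominus> r \<otimes> q')"
      unfolding qr(3) qs(3) using cr(1,4-7) by algebra
    finally have eq: "y \<ominus> r \<otimes> inv s = p \<otimes> (q \<otimes> s \<ominus> r \<otimes> q') \<otimes> (inv g \<otimes> inv s)" .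
    have "ord_ge (0 + 0) (inv g \<otimes> inv s)"
      using ci v_inv[OF cr(3) fg(3)] v_inv[OF cr(7) s(1)] fg(4) s(2)
      by (intro ord_ge_mult) (auto simp: val_ge_def)
    moreover have "ord_ge 0 (q \<otimes> s \<ominus> r \<otimes> q')"
      using cr AO qr qs rs by (intro ord_ge_diff ord_ge_mult0) auto
    ultimately have "ord_ge (1 + 0 + 0) (y \<ominus> r \<otimes> inv s)"
      unfolding eq using cr ci p1 by (intro ord_ge_mult) auto
    moreover have "r \<otimes> inv s \<in> T"
      using qr(2) qs(2) s by (auto simp: T_def)
    ultimately show ?thesis by auto
  qed
  ultimately show ?thesis
    unfolding finite_residues_def by blast
qed

end

section \<open>Sums of two squares in the residue field\<close>

lemma (in ring) normalize_eq_Nil_iff: "normalize p = [] \<longleftrightarrow> set p \<subseteq> {\<zero>}"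
  by (induction p) auto

lemma (in cring) eval_map_mult:
  assumes "c \<in> carrier R" "x \<in> carrier R" "set p \<subseteq> carrier R"
  shows "eval (map (\<lambda>d. c \<otimes> d) p) x = c \<otimes> eval p x"
  using assms(3) by (induction p) (use assms eval_in_carrier in \<open>auto simp: r_distr m_assoc\<close>)

context discrete_valuation
begin

lemma exists_primitive_relation:
  assumes k: "subfield k R" and alg: "(algebraic over k) u" and u: "u \<in> carrier R"
  shows "\<exists>p. set p \<subseteq> k \<inter> val_ring \<and> \<one> \<in> set p \<and> eval p u = \<zero>"
proof -
  note kE = subringE[OF subfieldE(1)[OF k]]
  obtain p where p: "p \<in> carrier (k[X])" "p \<noteq> []" "eval p u = \<zero>"
    using algebraicE[OF subfieldE(1)[OF k] u alg] by blast
  then have pk: "set p \<subseteq> k" and lead: "hd p \<noteq> \<zero>"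
    by (auto simp: univ_poly_carrier[symmetric] polynomial_def)
  define S where "S = {d \<in> set p. d \<noteq> \<zero>}"
  have S: "S \<noteq> {}" "finite S"
    using lead hd_in_set[OF p(2)] unfolding S_def by auto
  then obtain c where c: "c \<in> S" "\<And>d. d \<in> S \<Longrightarrow> v c \<le> v d"
    using arg_min_if_finite(1)[OF S(2,1), of v] arg_min_least[OF S(2,1), of _ v] by blast
  then have c': "c \<in> set p" "c \<noteq> \<zero>" "c \<in> k" "c \<in> carrier R"
    using pk kE(1) by (auto simp: S_def)
  have ic: "inv c \<in> k"
    using subfield_m_inv(1)[OF k, of c] c' by simp
  define q where "q = map (\<lambda>d. inv c \<otimes> d) p"
  have "inv c \<otimes> d \<in> k \<inter> val_ring" if "d \<in> set p" for d
  proof (cases "d = \<zero>")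
    case False
    then have d: "v c \<le> v d" "d \<in> k" "d \<in> carrier R"
      using c(2) that pk kE(1) by (auto simp: S_def)
    then have "v (inv c \<otimes> d) = v d - v c" "inv c \<otimes> d \<noteq> \<zero>"
      using False c' by (auto simp: v_mult v_inv nonzero_mult)
    then show ?thesis
      using d ic kE(1,6) c' by (auto simp: val_ring_def val_ge_def)
  qed (use ic kE in \<open>auto simp: val_ring_def\<close>)
  then have "set q \<subseteq> k \<inter> val_ring"
    by (auto simp: q_def)
  moreover have "\<one> \<in> set q"
    using c' by (auto simp: q_def image_iff intro!: bexI[of _ c])
  moreover have "eval q u = \<zero>"
    using eval_map_mult[of "inv c" u p] c' u pk kE(1) p(3) by (auto simp: q_def)
  ultimately show ?thesis by blast
qed

lemma sum_of_two_squares_mod_max_ideal: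
  assumes k: "subfield k R" and alg: "\<And>x. x \<in> carrier R \<Longrightarrow> (algebraic over k) x"
    and fin: "finite_residues k" and u: "u \<in> val_ring"
  shows "\<exists>y\<in>val_ring. \<exists>z\<in>val_ring. ord_ge 1 (u \<ominus> (y \<otimes> y \<oplus> z \<otimes> z))"
proof -
  interpret V: cring VR by (rule cring_VR)
  interpret L: field residue_field by (rule field_residue_field)
  interpret h: ring_hom_ring VR residue_field residue by (rule residue_hom)
  note kE = subringE[OF subfieldE(1)[OF k]]
  note OE = subringE[OF subring_val_ring]
  define F where "F = residue ` (k \<inter> val_ring)"
  have "finite F"
  proof -
    obtain T where T: "finite T" "T \<subseteq> val_ring" "\<And>y. y \<in> k \<inter> val_ring \<Longrightarrow> \<exists>t\<in>T. ord_ge 1 (y \<ominus> t)"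
      using fin unfolding finite_residues_def by blast
    have "residue y \<in> residue ` T" if "y \<in> k \<inter> val_ring" for y
      using T(3)[OF that] T(2) that residue_eq_iff[of y] by blast
    then have "F \<subseteq> residue ` T"
      by (auto simp: F_def)
    then show ?thesis
      using T(1) finite_surj by blast
  qed
  have subr: "subring F residue_field"
  proof (rule L.subringI)
    show "F \<subseteq> carrier residue_field"
      using h.hom_closed by (auto simp: F_def)
    show "\<one>\<^bsub>residue_field\<^esub> \<in> F"
      using h.hom_one kE(3) OE(3) by (auto simp: F_def image_iff intro!: bexI[of _ \<one>])
    show "\<ominus>\<^bsub>residue_field\<^esub> x \<in> F" if "x \<in> F" for x
    proof -
      obtain a where a: "a \<in> k" "a \<in> val_ring" "x = residue a"
        using \<open>x \<in> F\<close> unfolding F_def by blast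
      then have "\<ominus>\<^bsub>residue_field\<^esub> x = residue (\<ominus> a)"
        using h.hom_a_inv[of a] VR_a_inv by simp
      then show ?thesis
        using a kE(5) OE(5) unfolding F_def by blast
    qed
    fix x y assume "x \<in> F" "y \<in> F"
    then obtain a b where ab: "a \<in> k" "a \<in> val_ring" "x = residue a" "b \<in> k" "b \<in> val_ring" "y = residue b"
      unfolding F_def by blast
    have "x \<otimes>\<^bsub>residue_field\<^esub> y = residue (a \<otimes> b)" "x \<oplus>\<^bsub>residue_field\<^esub> y = residue (a \<oplus> b)"
      using ab h.hom_mult[of a b] h.hom_add[of a b] by simp_all
    moreover have "a \<otimes> b \<in> k \<inter> val_ring" "a \<oplus> b \<in> k \<inter> val_ring"
      using ab kE(6,7) OE(6,7) by blast+
    ultimately show "x \<otimes>\<^bsub>residue_field\<^esub> y \<in> F" "x \<oplus>\<^bsub>residue_field\<^esub> y \<in> F"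
      unfolding F_def by blast+
  qed
  have subf: "subfield F residue_field"
  proof (rule L.subfieldI'[OF subr])
    fix x assume x: "x \<in> F - {\<zero>\<^bsub>residue_field\<^esub>}"
    then obtain a where a: "a \<in> k" "a \<in> val_ring" "x = residue a"
      unfolding F_def by blast
    then have "residue a \<noteq> residue \<zero>"
      using x h.hom_zero by simp
    then have "\<not> ord_ge 1 (a \<ominus> \<zero>)"
      using residue_eq_iff[OF a(2) OE(2)] by simp
    moreover have aR: "a \<in> carrier R" "ord_ge 0 a"
      using a val_ringD by auto
    ultimately have a0: "a \<noteq> \<zero>" "v a = 0"
      by (auto simp: val_ge_def a_minus_def)
    then have ia: "inv a \<in> k" "inv a \<in> val_ring"
      using subfield_m_inv(1)[OF k, of a] a aR v_inv[of a] by (auto simp: val_ring_def val_ge_def)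
    have "x \<otimes>\<^bsub>residue_field\<^esub> residue (inv a) = \<one>\<^bsub>residue_field\<^esub>"
      using h.hom_mult[of a "inv a"] h.hom_one a aR a0 ia by simp
    then have "inv\<^bsub>residue_field\<^esub> x = residue (inv a)"
      using L.comm_inv_char[of x "residue (inv a)"] a ia h.hom_closed by simp
    then show "inv\<^bsub>residue_field\<^esub> x \<in> F"
      using ia by (auto simp: F_def)
  qed
  have uR: "u \<in> carrier R"
    using u val_ringD by simp
  obtain p where p: "set p \<subseteq> k \<inter> val_ring" "\<one> \<in> set p" "eval p u = \<zero>"
    using exists_primitive_relation[OF k alg[OF uR] uR] by blast
  define q where "q = map residue p"
  have qF: "set q \<subseteq> F"
    using p(1) by (auto simp: q_def F_def)
  then have qL: "set q \<subseteq> carrier residue_field"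
    using subringE(1)[OF subr] by blast
  have ru: "residue u \<in> carrier residue_field"
    using h.hom_closed u by simp
  have "L.eval q (residue u) = residue (eval p u)"
    using h.eval_hom'[of u p] p(1) u eval_consistent[OF subring_val_ring] by (auto simp: q_def)
  then have "L.eval (L.normalize q) (residue u) = \<zero>\<^bsub>residue_field\<^esub>"
    using p(3) h.hom_zero L.eval_normalize[OF qL ru] by simp
  moreover have "L.normalize q \<noteq> []"
    using p(2) h.hom_one L.one_not_zero by (force simp: L.normalize_eq_Nil_iff q_def)
  moreover have "L.normalize q \<in> carrier (F [X]\<^bsub>residue_field\<^esub>)"
    using L.normalize_gives_polynomial[OF qF] by (simp add: univ_poly_carrier)
  ultimately have "(L.algebraic over F) (residue u)"
    by (intro L.algebraicI)
  then have "L.finite_dimension F (L.simple_extension F (residue u))"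
    using L.finite_dimension_simple_extension[OF subf ru] by simp
  then have "finite (L.simple_extension F (residue u))"
    by (rule L.finite_dimension_imp_finite[OF \<open>finite F\<close>])
  moreover have subS: "subring (L.simple_extension F (residue u)) residue_field"
    by (rule L.simple_extension_is_subring[OF subr ru])
  moreover have "residue u \<in> L.simple_extension F (residue u)"
    by (rule L.simple_extension_mem[OF subr ru])
  ultimately obtain y z
    where "y \<in> L.simple_extension F (residue u)" "z \<in> L.simple_extension F (residue u)"
      and yz: "residue u = y \<otimes>\<^bsub>residue_field\<^esub> y \<oplus>\<^bsub>residue_field\<^esub> z \<otimes>\<^bsub>residue_field\<^esub> z"
    using L.sum_of_two_squares_finite_subring[OF subS] by metis
  then have "y \<in> carrier residue_field" "z \<in> carrier residue_field"
    using subsetD[OF subringE(1)[OF subS]] by simp_all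
  then obtain a b where ab: "a \<in> val_ring" "y = residue a" "b \<in> val_ring" "z = residue b"
    using residue_surj[of y] residue_surj[of z] by metis
  have "residue u = residue (a \<otimes> a \<oplus> b \<otimes> b)"
    using yz ab OE(6) h.hom_mult[of a a] h.hom_mult[of b b] h.hom_add[of "a \<otimes> a" "b \<otimes> b"] by simp
  then have "ord_ge 1 (u \<ominus> (a \<otimes> a \<oplus> b \<otimes> b))"
    using residue_eq_iff[of u "a \<otimes> a \<oplus> b \<otimes> b"] u ab OE(6,7) by simp
  with ab show ?thesis by blast
qed

text \<open>If \<open>v\<close> were trivial on \<open>k\<close>, an element \<open>x\<close> of value \<open>-1\<close> could not be algebraic: the leading
  term of a polynomial in \<open>x\<close> strictly dominates all others.\<close>
lemma exists_pos_value_in_subfield: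
  assumes k: "subfield k R" and alg: "\<And>x. x \<in> carrier R \<Longrightarrow> (algebraic over k) x"
  shows "\<exists>c\<in>k. c \<noteq> \<zero> \<and> v c > 0"
proof (rule ccontr)
  note kE = subringE[OF subfieldE(1)[OF k]]
  assume neg: "\<not> ?thesis"
  have triv: "v c = 0" if "c \<in> k" "c \<noteq> \<zero>" for c
  proof -
    have "c \<in> carrier R" "inv c \<in> k"
      using that kE(1) subfield_m_inv(1)[OF k, of c] by auto
    then have "\<not> v c > 0" "\<not> v (inv c) > 0"
      using neg that by auto
    then show ?thesis
      using v_inv[of c] that \<open>c \<in> carrier R\<close> by simp
  qed
  obtain x where x: "x \<in> carrier R" "x \<noteq> \<zero>" "v x = -1"
    using v_surj by blast
  have monom: "ord_ge (- int n) (c \<otimes> x [^] n)" if "c \<in> k" for c n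
  proof -
    have "ord_ge (0 + - int n) (c \<otimes> x [^] n)"
      using that kE(1) triv x v_pow[of x n] by (intro ord_ge_mult) (auto simp: val_ge_def)
    then show ?thesis by simp
  qed
  have bound: "ord_ge (1 - int (length p)) (eval p x)" if "set p \<subseteq> k" for p
    using that
  proof (induction p)
    case (Cons c p)
    then have c: "c \<in> k" "c \<in> carrier R" "set p \<subseteq> carrier R"
      using kE(1) by auto
    have "ord_ge (- int (length p)) (c \<otimes> x [^] length p \<oplus> eval p x)"
    proof (rule ord_ge_add)
      show "ord_ge (- int (length p)) (eval p x)"
        using Cons by (auto intro: ord_ge_mono)
    qed (use c x eval_in_carrier monom in simp_all)
    then show ?case by simp
  qed simp
  obtain p where p: "p \<in> carrier (k[X])" "p \<noteq> []" "eval p x = \<zero>"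
    using algebraicE[OF subfieldE(1)[OF k] x(1) alg[OF x(1)]] by blast
  then obtain c q where cq: "p = c # q" "c \<noteq> \<zero>" "c \<in> k" "set q \<subseteq> k"
    by (cases p) (auto simp: univ_poly_carrier[symmetric] polynomial_def)
  have cR: "c \<in> carrier R" "set q \<subseteq> carrier R"
    using cq kE(1) by auto
  have nz: "c \<otimes> x [^] length q \<noteq> \<zero>" and "v (c \<otimes> x [^] length q) = - int (length q)"
    using cR cq triv[of c] x by (auto simp: v_mult v_pow pow_nonzero nonzero_mult)
  then have "c \<otimes> x [^] length q \<oplus> eval q x \<noteq> \<zero>"
    using v_add_eq(1)[of "c \<otimes> x [^] length q" "eval q x"] bound[OF cq(4)] cR x eval_in_carrier by simp
  then show False
    using p(3) cq(1) by simp
qed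

end

section \<open>Global fields\<close>

context discrete_valuation
begin

lemma number_field_finite_residues:
  assumes "number_field R"
  shows "\<exists>k. subfield k R \<and> (\<forall>x\<in>carrier R. (algebraic over k) x) \<and> finite_residues k"
proof -
  define Q where "Q = (ring_of_type_algebra :: rat ring)"
  obtain h where h: "h \<in> ring_hom Q R" and fd: "finite_dimension (range h) (carrier R)"
    using assms unfolding number_field_def Q_def by auto
  have Q_simps: "carrier Q = UNIV" "x \<oplus>\<^bsub>Q\<^esub> y = x + y" "x \<otimes>\<^bsub>Q\<^esub> y = x * y" "\<one>\<^bsub>Q\<^esub> = 1" "\<zero>\<^bsub>Q\<^esub> = 0" for x y
    by (simp_all add: Q_def ring_of_type_algebra_def)
  interpret Q: field Q
    unfolding Q_def by (rule field_from_type_algebra)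
  interpret h: ring_hom_ring Q R h
    using h by (intro ring_hom_ringI2 Q.ring_axioms ring_axioms)
  have hc [simp]: "h q \<in> carrier R" for q
    using h.hom_closed by (simp add: Q_simps)
  have h_add: "h (x + y) = h x \<oplus> h y" and h_mult: "h (x * y) = h x \<otimes> h y"
    and h_one: "h 1 = \<one>" and h_zero: "h 0 = \<zero>" for x y
    using h.hom_add[of x y] h.hom_mult[of x y] h.hom_one h.hom_zero by (simp_all add: Q_simps)
  have h_minus: "h (- x) = \<ominus> h x" for x
    using h_add[of x "- x"] h_zero by (metis add.right_inverse hc local.minus_minus minus_equality a_comm)
  have subf: "subfield (range h) R" and inj: "inj h"
    using h.img_is_subfield[OF Q.carrier_is_subfield one_not_zero] by (simp_all add: Q_simps)
  have alg: "(algebraic over (range h)) x" if "x \<in> carrier R" for x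
    using finite_dimension_imp_algebraic[OF subf carrier_is_subring fd that] .
  define B where "B n = (\<lambda>i::int. h (of_int i)) ` {i. i = 0 \<or> \<bar>i\<bar> < int n}" for n
  define A where "A = range (\<lambda>i::int. h (of_int i))"
  have A_alt: "A = (\<Union>n. B n)"
  proof -
    have "h (of_int i) \<in> B (Suc (nat \<bar>i\<bar>))" for i :: int
      by (auto simp: B_def)
    moreover have "B n \<subseteq> A" for n
      by (auto simp: A_def B_def)
    ultimately show ?thesis
      unfolding A_def by blast
  qed
  have nat_O: "h (of_nat n) \<in> val_ring" for n
    by (induction n)
      (use subringE[OF subring_val_ring] in \<open>auto simp: h_add h_one h_zero\<close>)
  have A_sub: "A \<subseteq> val_ring"
  proof -
    have "h (of_int i) \<in> val_ring" for i :: int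
      by (cases i rule: int_cases2)
        (use nat_O subringE(5)[OF subring_val_ring] in \<open>auto simp: h_minus\<close>)
    then show ?thesis by (auto simp: A_def)
  qed
  have "finite_residues (range h)"
  proof (rule finite_residues_if_euclidean[OF A_alt A_sub])
    show "finite (B n)" for n
    proof -
      have "{i::int. i = 0 \<or> \<bar>i\<bar> < int n} \<subseteq> {- int n..int n}"
        by auto
      then show ?thesis
        unfolding B_def by (meson finite_atLeastAtMost_int finite_imageI finite_subset)
    qed
    show "B 0 \<subseteq> {\<zero>}"
      by (auto simp: B_def h_zero)
    show "\<exists>q\<in>A. \<exists>r\<in>B n. g = p \<otimes> q \<oplus> r" if pg: "p \<in> B (Suc n)" "p \<notin> B n" "g \<in> A" for n p g
    proof -
      obtain i j :: int where ij: "p = h (of_int j)" "j = 0 \<or> \<bar>j\<bar> < int (Suc n)" "g = h (of_int i)"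
        using pg by (auto simp: A_def B_def)
      have j: "j \<noteq> 0" "\<bar>j\<bar> = int n"
        using pg(2) ij by (auto simp: B_def)
      have "g = h (of_int (j * (i div j) + i mod j))"
        using ij by simp
      also have "\<dots> = p \<otimes> h (of_int (i div j)) \<oplus> h (of_int (i mod j))"
        unfolding of_int_add of_int_mult h_add h_mult ij ..
      finally have "g = p \<otimes> h (of_int (i div j)) \<oplus> h (of_int (i mod j))" .
      moreover have "h (of_int (i mod j)) \<in> B n"
        using abs_mod_less[OF j(1), of i] j(2) by (auto simp: B_def)
      ultimately show ?thesis
        by (auto simp: A_def)
    qed
    show "\<exists>f\<in>A. \<exists>g\<in>A. g \<noteq> \<zero> \<and> y = f \<otimes> inv g" if "y \<in> range h" for y
    proof -
      obtain q where q: "y = h q"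
        using \<open>y \<in> range h\<close> by blast
      obtain a b where ab: "b > 0" "q = of_int a / of_int b"
        by (cases q) (auto simp: Fract_of_int_quotient)
      have nz: "h (of_int b) \<noteq> \<zero>"
      proof
        assume "h (of_int b) = \<zero>"
        then have "of_int b = (0::rat)"
          using inj h_zero by (metis injD)
        then show False using ab by simp
      qed
      have "y \<otimes> h (of_int b) = h (of_int a)"
        using ab q by (simp add: h_mult[symmetric])
      then have "h (of_int a) \<otimes> inv (h (of_int b)) = y"
        using nz q m_assoc[of y "h (of_int b)" "inv (h (of_int b))"] by auto
      with nz show ?thesis
        unfolding A_def by blast
    qed
    show "\<exists>c\<in>range h. c \<noteq> \<zero> \<and> v c > 0"
      by (rule exists_pos_value_in_subfield[OF subf alg])
  qed
  then show ?thesis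
    using subf alg by blast
qed

lemma generate_field_subset_fractions:
  assumes A: "subring A R" and H: "\<And>x. x \<in> H \<Longrightarrow> \<exists>f\<in>A. \<exists>g\<in>A. g \<noteq> \<zero> \<and> x = f \<otimes> inv g"
    and y: "y \<in> generate_field R H"
  shows "\<exists>f\<in>A. \<exists>g\<in>A. g \<noteq> \<zero> \<and> y = f \<otimes> inv g"
  using y
proof (induction rule: generate_field.induct)
  note AE = subringE[OF A]
  have Ac: "x \<in> carrier R" if "x \<in> A" for x
    using AE(1) that by blast
  {
    case one
    show ?case
      using AE(3) by (intro bexI[of _ \<one>]) auto
  next
    case (incl h)
    then show ?case by (rule H)
  next
    case (a_inv h)
    then obtain f g where "f \<in> A" "g \<in> A" "g \<noteq> \<zero>" "h = f \<otimes> inv g" by blast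
    then show ?case
      using AE(5) Ac by (intro bexI[of _ "\<ominus> f"] bexI[of _ g]) (auto simp: l_minus)
  next
    case (m_inv h)
    then obtain f g where fg: "f \<in> A" "g \<in> A" "g \<noteq> \<zero>" "h = f \<otimes> inv g" by blast
    have f: "f \<noteq> \<zero>"
      using m_inv fg Ac by auto
    have c: "f \<in> carrier R" "g \<in> carrier R" "inv f \<in> carrier R" "inv g \<in> carrier R"
      using fg f Ac by auto
    have "h \<otimes> (g \<otimes> inv f) = (f \<otimes> inv f) \<otimes> (g \<otimes> inv g)"
      unfolding fg(4) using c by algebra
    also have "\<dots> = \<one>"
      using c f fg by simp
    finally have "inv h = g \<otimes> inv f"
      using c fg by (intro comm_inv_char) auto
    then show ?case
      using fg f by blast
  next
    case (eng_add h1 h2)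
    then obtain f g f' g' where fg: "f \<in> A" "g \<in> A" "g \<noteq> \<zero>" "h1 = f \<otimes> inv g"
      "f' \<in> A" "g' \<in> A" "g' \<noteq> \<zero>" "h2 = f' \<otimes> inv g'" by metis
    have c: "f \<in> carrier R" "g \<in> carrier R" "inv g \<in> carrier R"
      "f' \<in> carrier R" "g' \<in> carrier R" "inv g' \<in> carrier R"
      using fg Ac by auto
    have "(f \<otimes> g' \<oplus> f' \<otimes> g) \<otimes> (inv g \<otimes> inv g') =
        f \<otimes> inv g \<otimes> (g' \<otimes> inv g') \<oplus> f' \<otimes> inv g' \<otimes> (g \<otimes> inv g)"
      using c by algebra
    also have "\<dots> = h1 \<oplus> h2"
      using c fg by simp
    also have "inv g \<otimes> inv g' = inv (g \<otimes> g')"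
    proof (rule comm_inv_char[symmetric])
      have "g \<otimes> g' \<otimes> (inv g \<otimes> inv g') = (g \<otimes> inv g) \<otimes> (g' \<otimes> inv g')"
        using c by algebra
      then show "g \<otimes> g' \<otimes> (inv g \<otimes> inv g') = \<one>"
        using c fg by simp
    qed (use c in auto)
    finally have "h1 \<oplus> h2 = (f \<otimes> g' \<oplus> f' \<otimes> g) \<otimes> inv (g \<otimes> g')" by simp
    moreover have "f \<otimes> g' \<oplus> f' \<otimes> g \<in> A" "g \<otimes> g' \<in> A"
      using fg AE(6,7) by simp_all
    ultimately show ?case
      using nonzero_mult[of g g'] fg c by blast
  next
    case (eng_mult h1 h2)
    then obtain f g f' g' where fg: "f \<in> A" "g \<in> A" "g \<noteq> \<zero>" "h1 = f \<otimes> inv g"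
      "f' \<in> A" "g' \<in> A" "g' \<noteq> \<zero>" "h2 = f' \<otimes> inv g'" by metis
    have c: "f \<in> carrier R" "g \<in> carrier R" "inv g \<in> carrier R"
      "f' \<in> carrier R" "g' \<in> carrier R" "inv g' \<in> carrier R"
      using fg Ac by auto
    have "h1 \<otimes> h2 = (f \<otimes> f') \<otimes> (inv g \<otimes> inv g')"
      unfolding fg using c by algebra
    also have "inv g \<otimes> inv g' = inv (g \<otimes> g')"
    proof (rule comm_inv_char[symmetric])
      have "g \<otimes> g' \<otimes> (inv g \<otimes> inv g') = (g \<otimes> inv g) \<otimes> (g' \<otimes> inv g')"
        using c by algebra
      then show "g \<otimes> g' \<otimes> (inv g \<otimes> inv g') = \<one>"
        using c fg by simp
    qed (use c in auto)
    finally have "h1 \<otimes> h2 = (f \<otimes> f') \<otimes> inv (g \<otimes> g')" .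
    moreover have "f \<otimes> f' \<in> A" "g \<otimes> g' \<in> A"
      using fg AE(6,7) by simp_all
    ultimately show ?case
      using nonzero_mult[of g g'] fg c by blast
  }
qed

lemma finite_subfield_subset_val_ring:
  assumes F: "subfield F R" "finite F"
  shows "F \<subseteq> val_ring"
proof
  note FE = subringE[OF subfieldE(1)[OF F(1)]]
  fix c assume c: "c \<in> F"
  show "c \<in> val_ring"
  proof (cases "c = \<zero> \<or> v c = 0")
    case True
    then show ?thesis
      using c FE(1) by (auto simp: val_ring_def val_ge_def)
  next
    case False
    have cR: "c \<in> carrier R"
      using c FE(1) by blast
    have "c [^] n \<in> F" for n :: nat
      by (induction n) (use c FE in auto)
    then have "finite (range (\<lambda>n::nat. c [^] n))"
      using F(2) by (meson finite_subset image_subsetI)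
    moreover have "inj (\<lambda>n::nat. c [^] n)"
    proof (rule injI)
      fix m n :: nat assume "c [^] m = c [^] n"
      then have "v (c [^] m) = v (c [^] n)" by simp
      then show "m = n"
        using cR False by (simp add: v_pow)
    qed
    ultimately show ?thesis
      using finite_imageD infinite_UNIV_nat by blast
  qed
qed

lemma function_field_finite_residues:
  assumes "global_function_field R"
  shows "\<exists>k. subfield k R \<and> (\<forall>x\<in>carrier R. (algebraic over k) x) \<and> finite_residues k"
proof -
  obtain F t where F: "subfield F R" "finite F" and t: "t \<in> carrier R"
    and fd: "finite_dimension (generate_field R (insert t F)) (carrier R)"
    using assms unfolding global_function_field_def by blast
  note subF = subfieldE(1)[OF F(1)]
  note FE = subringE[OF subF]
  define k where "k = generate_field R (insert t F)"
  have subf: "subfield k R"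
    unfolding k_def using t FE(1) by (intro generate_field_is_subfield) auto
  have alg: "(algebraic over k) x" if "x \<in> carrier R" for x
    using finite_dimension_imp_algebraic[OF subf carrier_is_subring fd[folded k_def] that] .
  \<comment> \<open>\<open>t\<close> may have a pole at the place; then \<open>1/t\<close> generates the same field and is integral.\<close>
  define s where "s = (if ord_ge 0 t then t else inv t)"
  have s: "s \<in> val_ring"
    using t v_inv[of t] by (auto simp: s_def val_ring_def val_ge_def)
  then have sR: "s \<in> carrier R"
    using val_ringD by blast
  define B where "B n = (\<lambda>p. eval p s) ` {p \<in> carrier (F[X]). length p \<le> n}" for n
  define A where "A = simple_extension F s"
  have subA: "subring A R"
    unfolding A_def by (rule simple_extension_is_subring[OF subF sR])
  have A_img: "A = (\<lambda>p. eval p s) ` carrier (F[X])"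
    unfolding A_def by (rule simple_extension_as_eval_img[OF FE(1) sR])
  have A_alt: "A = (\<Union>n. B n)"
    by (auto simp: A_img B_def)
  have A_sub: "A \<subseteq> val_ring"
    unfolding A_def
    by (rule simple_extension_subring_incl[OF subring_val_ring finite_subfield_subset_val_ring[OF F] s])
  interpret ev: ring_hom_ring "F[X]" R "\<lambda>p. eval p s"
    by (rule eval_ring_hom[OF subF sR])
  have "finite_residues k"
  proof (rule finite_residues_if_euclidean[OF A_alt A_sub])
    show "finite (B n)" for n
    proof -
      have "{p \<in> carrier (F[X]). length p \<le> n} \<subseteq> {p. set p \<subseteq> F \<and> length p \<le> n}"
        by (auto simp: univ_poly_carrier[symmetric] polynomial_def)
      then show ?thesis
        unfolding B_def using finite_lists_length_le[OF F(2), of n]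
        by (meson finite_imageI finite_subset)
    qed
    show "B 0 \<subseteq> {\<zero>}"
      by (auto simp: B_def)
    show "\<exists>q\<in>A. \<exists>r\<in>B n. g = p \<otimes> q \<oplus> r" if pg: "p \<in> B (Suc n)" "p \<notin> B n" "g \<in> A" for n p g
    proof -
      obtain P where P: "P \<in> carrier (F[X])" "p = eval P s" "length P \<le> Suc n"
        using pg(1) by (auto simp: B_def)
      then have lenP: "length P = Suc n"
        using pg(2) by (auto simp: B_def le_Suc_eq)
      obtain G where G: "G \<in> carrier (F[X])" "g = eval G s"
        using pg(3) A_img by auto
      have "P \<noteq> \<zero>\<^bsub>F[X]\<^esub>"
        using lenP by (auto simp: univ_poly_zero)
      then obtain q r where qr: "q \<in> carrier (F[X])" "r \<in> carrier (F[X])"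
        "G = (P \<otimes>\<^bsub>F[X]\<^esub> q) \<oplus>\<^bsub>F[X]\<^esub> r" "r = \<zero>\<^bsub>F[X]\<^esub> \<or> length r - 1 < length P - 1"
        using subfield_long_division_theorem_shell[OF F(1) G(1) P(1)] by blast
      have "g = p \<otimes> eval q s \<oplus> eval r s"
        unfolding G(2) P(2) qr(3) using qr(1,2) P(1) by simp
      moreover have "length r \<le> n"
        using qr(4) lenP by (auto simp: univ_poly_zero)
      then have "eval r s \<in> B n"
        using qr(2) by (auto simp: B_def)
      ultimately show ?thesis
        using qr(1) A_img by blast
    qed
    show "\<exists>f\<in>A. \<exists>g\<in>A. g \<noteq> \<zero> \<and> y = f \<otimes> inv g" if "y \<in> k" for y
    proof (rule generate_field_subset_fractions[OF subA _ that[unfolded k_def]])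
      note AE = subringE[OF subA]
      have sA: "s \<in> A"
        unfolding A_def by (rule simple_extension_mem[OF subF sR])
      have *: "\<exists>f\<in>A. \<exists>g\<in>A. g \<noteq> \<zero> \<and> x = f \<otimes> inv g" if "x \<in> A" for x
        using that AE(1,3) by (intro bexI[of _ x] bexI[of _ \<one>]) auto
      fix x assume "x \<in> insert t F"
      then consider "x \<in> F" | "x = t" "ord_ge 0 t" | "x = t" "\<not> ord_ge 0 t"
        by blast
      then show "\<exists>f\<in>A. \<exists>g\<in>A. g \<noteq> \<zero> \<and> x = f \<otimes> inv g"
      proof cases
        case 1
        then have "x \<in> A"
          unfolding A_def using simple_extension_incl[OF FE(1) sR] by blast
        then show ?thesis by (rule *)
      next
        case 2
        then show ?thesis
          using * sA by (simp add: s_def)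
      next
        case 3
        then have "t \<noteq> \<zero>" by auto
        then have "inv s = t" "s \<noteq> \<zero>"
          using 3 t comm_inv_char[of "inv t" t] by (auto simp: s_def)
        then show ?thesis
          using sA AE(3) 3 t by (intro bexI[of _ \<one>] bexI[of _ s]) auto
      qed
    qed
    show "\<exists>c\<in>k. c \<noteq> \<zero> \<and> v c > 0"
      by (rule exists_pos_value_in_subfield[OF subf alg])
  qed
  then show ?thesis
    using subf alg by blast
qed

theorem global_field_sum_of_two_squares_mod:
  assumes "global_field R" "u \<in> carrier R" "ord_ge 0 u"
  obtains y z where "y \<in> carrier R" "z \<in> carrier R" "ord_ge 0 y" "ord_ge 0 z"
    "ord_ge 1 (u \<ominus> (y \<otimes> y \<oplus> z \<otimes> z))"
proof -
  obtain k where k: "subfield k R" "\<forall>x\<in>carrier R. (algebraic over k) x" "finite_residues k"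
    using assms(1) number_field_finite_residues function_field_finite_residues
    unfolding global_field_def by blast
  have "u \<in> val_ring"
    using assms by (simp add: val_ring_def)
  then show ?thesis
    using sum_of_two_squares_mod_max_ideal[OF k(1) _ k(3)] k(2) that by (force simp: val_ring_def)
qed

end

section \<open>Sums of squares\<close>

lemma (in ring) sum_of_squares_in_0 [simp]: "sum_of_squares_in R 0 x \<longleftrightarrow> x = \<zero>"
  by (auto simp: sum_of_squares_in_def)

lemma (in ring) sum_of_squares_in_Suc:
  "sum_of_squares_in R (Suc n) x \<longleftrightarrow>
     (\<exists>y\<in>carrier R. \<exists>w. sum_of_squares_in R n w \<and> x = y \<otimes> y \<oplus> w)"
proof
  assume "sum_of_squares_in R (Suc n) x"
  then obtain f where f: "f \<in> {..<Suc n} \<rightarrow> carrier R" "x = (\<Oplus>i\<in>{..<Suc n}. f i \<otimes> f i)"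
    unfolding sum_of_squares_in_def by blast
  then have fc: "f i \<in> carrier R" if "i \<le> n" for i
    using that by auto
  have "x = f n \<otimes> f n \<oplus> (\<Oplus>i\<in>{..<n}. f i \<otimes> f i)"
    unfolding f(2) lessThan_Suc using fc by (subst finsum_insert) auto
  moreover have "sum_of_squares_in R n (\<Oplus>i\<in>{..<n}. f i \<otimes> f i)"
    unfolding sum_of_squares_in_def using f(1) by (intro bexI[of _ f]) auto
  ultimately show "\<exists>y\<in>carrier R. \<exists>w. sum_of_squares_in R n w \<and> x = y \<otimes> y \<oplus> w"
    using fc by blast
next
  assume "\<exists>y\<in>carrier R. \<exists>w. sum_of_squares_in R n w \<and> x = y \<otimes> y \<oplus> w"
  then obtain y f where y: "y \<in> carrier R" and f: "f \<in> {..<n} \<rightarrow> carrier R"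
    and x: "x = y \<otimes> y \<oplus> (\<Oplus>i\<in>{..<n}. f i \<otimes> f i)"
    unfolding sum_of_squares_in_def by blast
  define g where "g = f(n := y)"
  have g: "g \<in> {..<Suc n} \<rightarrow> carrier R"
    using f y by (auto simp: g_def less_Suc_eq Pi_iff)
  then have gc: "g i \<in> carrier R" if "i \<le> n" for i
    using that by auto
  have "(\<Oplus>i\<in>{..<Suc n}. g i \<otimes> g i) = g n \<otimes> g n \<oplus> (\<Oplus>i\<in>{..<n}. g i \<otimes> g i)"
    unfolding lessThan_Suc using gc by (subst finsum_insert) auto
  also have "(\<Oplus>i\<in>{..<n}. g i \<otimes> g i) = (\<Oplus>i\<in>{..<n}. f i \<otimes> f i)"
    using f by (intro finsum_cong') (auto simp: g_def)
  finally show "sum_of_squares_in R (Suc n) x"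
    unfolding sum_of_squares_in_def using g x by (intro bexI[of _ g]) (auto simp: g_def)
qed

lemma (in ring) sum_of_squares_in_1:
  "sum_of_squares_in R (Suc 0) x \<longleftrightarrow> is_square_in R x"
  by (auto simp: sum_of_squares_in_Suc is_square_in_def)

lemma (in ring) sum_of_squares_in_2:
  "sum_of_squares_in R (Suc (Suc 0)) x \<longleftrightarrow>
     (\<exists>y\<in>carrier R. \<exists>z\<in>carrier R. x = y \<otimes> y \<oplus> z \<otimes> z)"
  by (subst sum_of_squares_in_Suc) (auto simp: sum_of_squares_in_1 is_square_in_def)

lemma square_length_eqI:
  assumes "sum_of_squares_in R n x" "\<And>m. m < n \<Longrightarrow> \<not> sum_of_squares_in R m x"
  shows "square_length R x = enat n"
  unfolding square_length_def
proof (rule antisym)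
  show "(INF n\<in>{n. sum_of_squares_in R n x}. enat n) \<le> enat n"
    using assms(1) by (intro INF_lower) simp
  show "enat n \<le> (INF n\<in>{n. sum_of_squares_in R n x}. enat n)"
    using assms(2) by (intro INF_greatest) (auto simp: not_less[symmetric])
qed

section \<open>The completion at a place\<close>

context discrete_valuation
begin

abbreviation CS :: "(nat \<Rightarrow> 'a) ring" where
  "CS \<equiv> cauchy_ring R v"

lemma CS_simps [simp]:
  "carrier CS = cauchy_seqs R v" "s \<otimes>\<^bsub>CS\<^esub> t = (\<lambda>n. s n \<otimes> t n)" "\<one>\<^bsub>CS\<^esub> = (\<lambda>_. \<one>)"
  "\<zero>\<^bsub>CS\<^esub> = (\<lambda>_. \<zero>)" "s \<oplus>\<^bsub>CS\<^esub> t = (\<lambda>n. s n \<oplus> t n)"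
  by (simp_all add: cauchy_ring_def)

lemma cauchy_seqsD:
  "s \<in> cauchy_seqs R v \<Longrightarrow> s n \<in> carrier R"
  "s \<in> cauchy_seqs R v \<Longrightarrow> \<exists>M. \<forall>m\<ge>M. \<forall>n\<ge>M. ord_ge N (s m \<ominus> s n)"
  by (auto simp: cauchy_seqs_def)

lemma null_seqsD:
  "s \<in> null_seqs R v \<Longrightarrow> s n \<in> carrier R"
  "s \<in> null_seqs R v \<Longrightarrow> \<exists>M. \<forall>n\<ge>M. ord_ge N (s n)"
  by (auto simp: null_seqs_def)

lemma null_imp_cauchy: "s \<in> null_seqs R v \<Longrightarrow> s \<in> cauchy_seqs R v"
proof -
  assume s: "s \<in> null_seqs R v"
  have "\<exists>M. \<forall>m\<ge>M. \<forall>n\<ge>M. ord_ge N (s m \<ominus> s n)" for N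
    using null_seqsD(2)[OF s, of N] null_seqsD(1)[OF s] by (meson ord_ge_diff)
  then show ?thesis
    using null_seqsD(1)[OF s] by (auto simp: cauchy_seqs_def)
qed

lemma const_cauchy [simp]: "a \<in> carrier R \<Longrightarrow> (\<lambda>_. a) \<in> cauchy_seqs R v"
  by (auto simp: cauchy_seqs_def a_minus_def r_neg)

lemma cauchy_bounded:
  assumes s: "s \<in> cauchy_seqs R v"
  obtains N where "N \<le> 0" "\<And>n. ord_ge N (s n)"
proof -
  obtain M where M: "\<And>m n. \<lbrakk>m \<ge> M; n \<ge> M\<rbrakk> \<Longrightarrow> ord_ge 0 (s m \<ominus> s n)"
    using cauchy_seqsD(2)[OF s] by blast
  define N where "N = min 0 (Min ((\<lambda>n. v (s n)) ` {..M}))"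
  have le: "ord_ge N (s n)" if "n \<le> M" for n
  proof -
    have "Min ((\<lambda>n. v (s n)) ` {..M}) \<le> v (s n)"
      using that by (intro Min_le) auto
    then have "N \<le> v (s n)"
      unfolding N_def by linarith
    then show ?thesis
      by (simp add: val_ge_def)
  qed
  have "ord_ge N (s n)" for n
  proof (cases "n \<le> M")
    case False
    then have "ord_ge N (s n \<ominus> s M)"
      using M[of n M] by (auto simp: N_def intro: ord_ge_mono)
    moreover have "s n = (s n \<ominus> s M) \<oplus> s M"
      using cauchy_seqsD(1)[OF s, of n] cauchy_seqsD(1)[OF s, of M] by algebra
    ultimately show ?thesis
      using ord_ge_add[of "s n \<ominus> s M" "s M" N] le[of M] cauchy_seqsD(1)[OF s] by simp
  qed (rule le)
  then show ?thesis
    using that[of N] by (simp add: N_def)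
qed

lemma cauchy_add:
  assumes s: "s \<in> cauchy_seqs R v" and t: "t \<in> cauchy_seqs R v"
  shows "(\<lambda>n. s n \<oplus> t n) \<in> cauchy_seqs R v"
proof -
  note sc = cauchy_seqsD(1)[OF s] and tc = cauchy_seqsD(1)[OF t]
  have "\<exists>M. \<forall>m\<ge>M. \<forall>n\<ge>M. ord_ge N (s m \<oplus> t m \<ominus> (s n \<oplus> t n))" for N
  proof -
    obtain M1 where M1: "\<And>m n. \<lbrakk>m \<ge> M1; n \<ge> M1\<rbrakk> \<Longrightarrow> ord_ge N (s m \<ominus> s n)"
      using cauchy_seqsD(2)[OF s] by blast
    obtain M2 where M2: "\<And>m n. \<lbrakk>m \<ge> M2; n \<ge> M2\<rbrakk> \<Longrightarrow> ord_ge N (t m \<ominus> t n)"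
      using cauchy_seqsD(2)[OF t] by blast
    have "ord_ge N (s m \<oplus> t m \<ominus> (s n \<oplus> t n))" if "m \<ge> max M1 M2" "n \<ge> max M1 M2" for m n
    proof -
      have "s m \<oplus> t m \<ominus> (s n \<oplus> t n) = (s m \<ominus> s n) \<oplus> (t m \<ominus> t n)"
        using sc[of m] sc[of n] tc[of m] tc[of n] by algebra
      then show ?thesis
        using ord_ge_add[OF _ _ M1[of m n] M2[of m n]] that sc tc by simp
    qed
    then show ?thesis by blast
  qed
  then show ?thesis
    using sc tc by (auto simp: cauchy_seqs_def)
qed

lemma cauchy_minus:
  assumes s: "s \<in> cauchy_seqs R v"
  shows "(\<lambda>n. \<ominus> s n) \<in> cauchy_seqs R v"
proof -
  note sc = cauchy_seqsD(1)[OF s]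
  have "\<ominus> s m \<ominus> \<ominus> s n = s n \<ominus> s m" for m n
    using sc[of m] sc[of n] by algebra
  then show ?thesis
    using s by (auto simp: cauchy_seqs_def) metis
qed

lemma cauchy_mult:
  assumes s: "s \<in> cauchy_seqs R v" and t: "t \<in> cauchy_seqs R v"
  shows "(\<lambda>n. s n \<otimes> t n) \<in> cauchy_seqs R v"
proof -
  note sc = cauchy_seqsD(1)[OF s] and tc = cauchy_seqsD(1)[OF t]
  obtain S where S: "S \<le> 0" "\<And>n. ord_ge S (s n)"
    using cauchy_bounded[OF s] by blast
  obtain T where T: "T \<le> 0" "\<And>n. ord_ge T (t n)"
    using cauchy_bounded[OF t] by blast
  have "\<exists>M. \<forall>m\<ge>M. \<forall>n\<ge>M. ord_ge N (s m \<otimes> t m \<ominus> s n \<otimes> t n)" for N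
  proof -
    obtain M1 where M1: "\<And>m n. \<lbrakk>m \<ge> M1; n \<ge> M1\<rbrakk> \<Longrightarrow> ord_ge (N - T) (s m \<ominus> s n)"
      using cauchy_seqsD(2)[OF s] by blast
    obtain M2 where M2: "\<And>m n. \<lbrakk>m \<ge> M2; n \<ge> M2\<rbrakk> \<Longrightarrow> ord_ge (N - S) (t m \<ominus> t n)"
      using cauchy_seqsD(2)[OF t] by blast
    have "ord_ge N (s m \<otimes> t m \<ominus> s n \<otimes> t n)" if "m \<ge> max M1 M2" "n \<ge> max M1 M2" for m n
    proof -
      have "s m \<otimes> t m \<ominus> s n \<otimes> t n = (s m \<ominus> s n) \<otimes> t m \<oplus> s n \<otimes> (t m \<ominus> t n)"
        using sc[of m] sc[of n] tc[of m] tc[of n] by algebra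
      moreover have "ord_ge (N - T + T) ((s m \<ominus> s n) \<otimes> t m)"
        using sc tc that M1 T by (intro ord_ge_mult) auto
      moreover have "ord_ge (S + (N - S)) (s n \<otimes> (t m \<ominus> t n))"
        using sc tc that M2 S by (intro ord_ge_mult) auto
      ultimately show ?thesis
        using sc tc by (auto intro: ord_ge_add)
    qed
    then show ?thesis by blast
  qed
  then show ?thesis
    using sc tc by (auto simp: cauchy_seqs_def)
qed

lemma cring_CS: "cring CS"
proof (rule cringI)
  show "abelian_group CS"
  proof (rule abelian_groupI)
    fix s assume s: "s \<in> carrier CS"
    then have "(\<lambda>n. \<ominus> s n) \<oplus>\<^bsub>CS\<^esub> s = \<zero>\<^bsub>CS\<^esub>"
      by (auto simp: cauchy_seqsD(1) l_neg)
    then show "\<exists>t\<in>carrier CS. t \<oplus>\<^bsub>CS\<^esub> s = \<zero>\<^bsub>CS\<^esub>"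
      using s cauchy_minus by (metis CS_simps(1))
  qed (simp_all add: cauchy_add cauchy_seqsD(1) a_ac)
  show "comm_monoid CS"
    by (rule comm_monoidI) (simp_all add: cauchy_mult cauchy_seqsD(1) m_ac)
qed (simp add: cauchy_seqsD(1) l_distr)

lemma CS_minus: "s \<in> cauchy_seqs R v \<Longrightarrow> \<ominus>\<^bsub>CS\<^esub> s = (\<lambda>n. \<ominus> s n)"
proof -
  interpret CS: cring CS by (rule cring_CS)
  assume s: "s \<in> cauchy_seqs R v"
  have "(\<lambda>n. \<ominus> s n) \<oplus>\<^bsub>CS\<^esub> s = \<zero>\<^bsub>CS\<^esub>"
    using s by (auto simp: cauchy_seqsD(1) l_neg)
  then show ?thesis
    using CS.minus_equality[of "\<lambda>n. \<ominus> s n" s] s cauchy_minus by simp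
qed

lemma ideal_null_seqs: "ideal (null_seqs R v) CS"
proof (rule idealI)
  interpret CS: cring CS by (rule cring_CS)
  show "ring CS" by (rule CS.ring_axioms)
  have add: "(\<lambda>n. s n \<oplus> t n) \<in> null_seqs R v" if s: "s \<in> null_seqs R v" and t: "t \<in> null_seqs R v" for s t
  proof -
    have "\<exists>M. \<forall>n\<ge>M. ord_ge N (s n \<oplus> t n)" for N
    proof -
      obtain M1 M2 where "\<And>n. n \<ge> M1 \<Longrightarrow> ord_ge N (s n)" "\<And>n. n \<ge> M2 \<Longrightarrow> ord_ge N (t n)"
        using null_seqsD(2)[OF s, of N] null_seqsD(2)[OF t, of N] by blast
      then show ?thesis
        using null_seqsD(1)[OF s] null_seqsD(1)[OF t]
        by (intro exI[of _ "max M1 M2"]) (auto intro: ord_ge_add)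
    qed
    then show ?thesis
      using null_seqsD(1)[OF s] null_seqsD(1)[OF t] by (auto simp: null_seqs_def)
  qed
  have minus: "(\<lambda>n. \<ominus> s n) \<in> null_seqs R v" if s: "s \<in> null_seqs R v" for s
  proof -
    have "\<exists>M. \<forall>n\<ge>M. ord_ge N (\<ominus> s n)" for N
      using null_seqsD(2)[OF s, of N] null_seqsD(1)[OF s] by (meson ord_ge_minus)
    then show ?thesis
      using null_seqsD(1)[OF s] by (auto simp: null_seqs_def)
  qed
  show "subgroup (null_seqs R v) (add_monoid CS)"
  proof (rule CS.add.subgroupI)
    show "null_seqs R v \<subseteq> carrier CS"
      using null_imp_cauchy by auto
    have "(\<lambda>_. \<zero>) \<in> null_seqs R v"
      by (auto simp: null_seqs_def)
    then show "null_seqs R v \<noteq> {}" by blast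
    show "\<ominus>\<^bsub>CS\<^esub> s \<in> null_seqs R v" if "s \<in> null_seqs R v" for s
      using minus[OF that] CS_minus[OF null_imp_cauchy[OF that]] by simp
  qed (use add in simp)
  have mult: "(\<lambda>n. t n \<otimes> s n) \<in> null_seqs R v" if s: "s \<in> null_seqs R v" and t: "t \<in> cauchy_seqs R v" for s t
  proof -
    obtain T where T: "\<And>n. ord_ge T (t n)"
      using cauchy_bounded[OF t] by blast
    have "\<exists>M. \<forall>n\<ge>M. ord_ge N (t n \<otimes> s n)" for N
    proof -
      obtain M where M: "\<And>n. n \<ge> M \<Longrightarrow> ord_ge (N - T) (s n)"
        using null_seqsD(2)[OF s] by blast
      have "ord_ge N (t n \<otimes> s n)" if "n \<ge> M" for n
        using ord_ge_mult[OF _ _ T M[OF that], of n] null_seqsD(1)[OF s] cauchy_seqsD(1)[OF t] by simp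
      then show ?thesis by blast
    qed
    then show ?thesis
      using null_seqsD(1)[OF s] cauchy_seqsD(1)[OF t] by (auto simp: null_seqs_def)
  qed
  fix s t assume s: "s \<in> null_seqs R v" and t: "t \<in> carrier CS"
  show "t \<otimes>\<^bsub>CS\<^esub> s \<in> null_seqs R v"
    using mult[OF s] t by simp
  then show "s \<otimes>\<^bsub>CS\<^esub> t \<in> null_seqs R v"
    using CS.m_comm[of s t] t null_imp_cauchy[OF s] by simp
qed

abbreviation C :: "(nat \<Rightarrow> 'a) set ring" where
  "C \<equiv> completion R v"

abbreviation cls :: "(nat \<Rightarrow> 'a) \<Rightarrow> (nat \<Rightarrow> 'a) set" where
  "cls \<equiv> (+>\<^bsub>CS\<^esub>) (null_seqs R v)"

abbreviation emb :: "'a \<Rightarrow> (nat \<Rightarrow> 'a) set" where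
  "emb \<equiv> to_completion R v"

lemma cring_completion: "cring C"
  unfolding completion_def by (rule ideal.quotient_is_cring[OF ideal_null_seqs cring_CS])

lemma cls_hom: "ring_hom_ring CS C cls"
  unfolding completion_def by (rule ideal.rcos_ring_hom_ring[OF ideal_null_seqs])

lemma cls_surj: "q \<in> carrier C \<Longrightarrow> \<exists>s\<in>cauchy_seqs R v. q = cls s"
  unfolding completion_def FactRing_simps by auto

lemma cls_eq_iff:
  assumes "s \<in> cauchy_seqs R v" "t \<in> cauchy_seqs R v"
  shows "cls s = cls t \<longleftrightarrow> (\<forall>N. \<exists>M. \<forall>n\<ge>M. ord_ge N (s n \<ominus> t n))"
proof -
  have "s \<ominus>\<^bsub>CS\<^esub> t = (\<lambda>n. s n \<ominus> t n)"
    using assms by (simp add: a_minus_def CS_minus)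
  then have "cls s = cls t \<longleftrightarrow> (\<lambda>n. s n \<ominus> t n) \<in> null_seqs R v"
    using ring.quotient_eq_iff_same_a_r_cos[OF ring_hom_ring.axioms(1)[OF cls_hom] ideal_null_seqs, of s t]
      assms by simp
  also have "\<dots> \<longleftrightarrow> (\<forall>N. \<exists>M. \<forall>n\<ge>M. ord_ge N (s n \<ominus> t n))"
    using assms cauchy_seqsD(1) by (auto simp: null_seqs_def)
  finally show ?thesis .
qed

lemma emb_eq: "emb a = cls (\<lambda>_. a)"
  by (simp add: to_completion_def)

lemma emb_hom: "ring_hom_cring R C emb"
proof -
  interpret c: ring_hom_ring CS C cls by (rule cls_hom)
  have "emb \<in> ring_hom R C"
  proof (rule ring_hom_memI)
    show "emb x \<in> carrier C" if "x \<in> carrier R" for x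
      using that c.hom_closed[of "\<lambda>_. x"] by (simp add: emb_eq)
    show "emb (x \<otimes> y) = emb x \<otimes>\<^bsub>C\<^esub> emb y" if "x \<in> carrier R" "y \<in> carrier R" for x y
      using that c.hom_mult[of "\<lambda>_. x" "\<lambda>_. y"] by (simp add: emb_eq)
    show "emb (x \<oplus> y) = emb x \<oplus>\<^bsub>C\<^esub> emb y" if "x \<in> carrier R" "y \<in> carrier R" for x y
      using that c.hom_add[of "\<lambda>_. x" "\<lambda>_. y"] by (simp add: emb_eq)
    show "emb \<one> = \<one>\<^bsub>C\<^esub>"
      using c.hom_one by (simp add: emb_eq)
  qed
  then show ?thesis
    using cring_completion is_cring by (simp add: ring_hom_cring_def ring_hom_cring_axioms_def)
qed

lemma emb_eq_zero_iff: "a \<in> carrier R \<Longrightarrow> emb a = \<zero>\<^bsub>C\<^esub> \<longleftrightarrow> a = \<zero>"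
proof
  interpret e: ring_hom_cring R C emb by (rule emb_hom)
  assume a: "a \<in> carrier R" "emb a = \<zero>\<^bsub>C\<^esub>"
  then have "cls (\<lambda>_. a) = cls (\<lambda>_. \<zero>)"
    using e.hom_zero by (simp add: emb_eq)
  then obtain M :: nat where M: "\<forall>n\<ge>M. ord_ge (v a + 1) (a \<ominus> \<zero>)"
    using cls_eq_iff[of "\<lambda>_. a" "\<lambda>_. \<zero>"] a by auto
  then have "ord_ge (v a + 1) (a \<ominus> \<zero>)"
    by (metis order_refl)
  then have "ord_ge (v a + 1) a"
    using a by (simp add: a_minus_def)
  then show "a = \<zero>"
    by (simp add: val_ge_def)
qed (use ring_hom_cring.hom_zero[OF emb_hom] in simp)

lemma sum_of_two_squares_approx:
  assumes a: "a \<in> carrier R" and x: "x \<in> carrier C" and y: "y \<in> carrier C"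
    and eq: "emb a = x \<otimes>\<^bsub>C\<^esub> x \<oplus>\<^bsub>C\<^esub> y \<otimes>\<^bsub>C\<^esub> y"
  shows "\<exists>s\<in>carrier R. \<exists>t\<in>carrier R. ord_ge N (a \<ominus> (s \<otimes> s \<oplus> t \<otimes> t))"
proof -
  interpret c: ring_hom_ring CS C cls by (rule cls_hom)
  obtain s t where st: "s \<in> cauchy_seqs R v" "x = cls s" "t \<in> cauchy_seqs R v" "y = cls t"
    using cls_surj x y by metis
  have "cls (\<lambda>_. a) = cls (\<lambda>n. s n \<otimes> s n \<oplus> t n \<otimes> t n)"
    using eq st c.hom_mult[of s s] c.hom_mult[of t t]
      c.hom_add[of "\<lambda>n. s n \<otimes> s n" "\<lambda>n. t n \<otimes> t n"] by (simp add: emb_eq cauchy_mult)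
  then have "\<forall>N. \<exists>M. \<forall>n\<ge>M. ord_ge N (a \<ominus> (s n \<otimes> s n \<oplus> t n \<otimes> t n))"
    using cls_eq_iff[of "\<lambda>_. a" "\<lambda>n. s n \<otimes> s n \<oplus> t n \<otimes> t n"] a st
    by (simp add: cauchy_mult cauchy_add)
  then obtain M where "\<forall>n\<ge>M. ord_ge N (a \<ominus> (s n \<otimes> s n \<oplus> t n \<otimes> t n))"
    by blast
  then show ?thesis
    using st cauchy_seqsD(1) by blast
qed

end

section \<open>Hensel's lemma for squares and local lengths\<close>

context discrete_valuation
begin

lemma v_square: "\<lbrakk>x \<in> carrier R; x \<noteq> \<zero>\<rbrakk> \<Longrightarrow> v (x \<otimes> x) = 2 * v x"
  by (simp add: v_mult)

lemma v_eq_zeroI_square_cong: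
  assumes "u \<in> carrier R" "y \<in> carrier R" "u \<noteq> \<zero>" "v u = 0" "ord_ge 1 (u \<ominus> y \<otimes> y)"
  shows "y \<noteq> \<zero>" "v y = 0"
proof -
  have "y \<otimes> y \<noteq> \<zero>" "v (y \<otimes> y) = 0"
    using v_cong[of u "y \<otimes> y"] assms by auto
  moreover from this show "y \<noteq> \<zero>"
    using assms(2) by auto
  ultimately show "v y = 0"
    using v_square[OF assms(2)] by simp
qed

lemma newton_step:
  assumes two: "\<one> \<oplus> \<one> \<noteq> \<zero>" "v (\<one> \<oplus> \<one>) = 0"
    and u: "u \<in> carrier R" and s: "s \<in> carrier R" "s \<noteq> \<zero>" "v s = 0"
    and n: "n \<ge> 1" "ord_ge n (s \<otimes> s \<ominus> u)"
    and s'_def: "s' = s \<ominus> (s \<otimes> s \<ominus> u) \<otimes> inv ((\<one> \<oplus> \<one>) \<otimes> s)"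
  shows "s' \<in> carrier R" "s' \<noteq> \<zero>" "v s' = 0" "ord_ge n (s' \<ominus> s)" "ord_ge (n + 1) (s' \<otimes> s' \<ominus> u)"
proof -
  define i where "i = inv ((\<one> \<oplus> \<one>) \<otimes> s)"
  have nz: "(\<one> \<oplus> \<one>) \<otimes> s \<noteq> \<zero>"
    using two s by (simp add: nonzero_mult)
  have i: "i \<in> carrier R" "(\<one> \<oplus> \<one>) \<otimes> s \<otimes> i = \<one>" "ord_ge 0 i"
    using nz s v_inv[OF _ nz] v_mult[OF _ s(1) two(1) s(2)] two by (auto simp: i_def val_ge_def)
  define e where "e = s \<otimes> s \<ominus> u"
  have e: "e \<in> carrier R" "ord_ge n e"
    using n(2) s u by (auto simp: e_def)
  define d where "d = e \<otimes> i"
  have d: "d \<in> carrier R" "ord_ge n d"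
    using ord_ge_mult[OF e(1) i(1) e(2) i(3)] e i by (auto simp: d_def)
  have s': "s' = s \<ominus> d"
    by (simp add: s'_def d_def e_def i_def)
  show "s' \<in> carrier R"
    using s d by (simp add: s')
  have diff: "s \<ominus> s' = d" "s' \<ominus> s = \<ominus> d"
    unfolding s' using s(1) d(1) by algebra+
  then have "ord_ge (v s + 1) (s \<ominus> s')"
    using ord_ge_mono[OF d(2)] n(1) s(3) by simp
  then show "s' \<noteq> \<zero>" "v s' = 0"
    using v_cong[OF s(1) \<open>s' \<in> carrier R\<close> s(2)] s(3) by auto
  show "ord_ge n (s' \<ominus> s)"
    unfolding diff using d ord_ge_minus by simp
  have "s' \<otimes> s' \<ominus> u = (s \<otimes> s \<ominus> u) \<ominus> (\<one> \<oplus> \<one>) \<otimes> s \<otimes> d \<oplus> d \<otimes> d"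
    unfolding s' using s(1) u d(1) by algebra
  also have "(\<one> \<oplus> \<one>) \<otimes> s \<otimes> d = ((\<one> \<oplus> \<one>) \<otimes> s \<otimes> i) \<otimes> e"
    using s(1) i(1) e(1) by (simp add: d_def m_ac)
  also have "\<dots> = s \<otimes> s \<ominus> u"
    unfolding i(2) using e(1) by (simp add: e_def)
  also have "s \<otimes> s \<ominus> u \<ominus> (s \<otimes> s \<ominus> u) \<oplus> d \<otimes> d = d \<otimes> d"
    using s(1) u d(1) by algebra
  finally show "ord_ge (n + 1) (s' \<otimes> s' \<ominus> u)"
    using ord_ge_mono[OF ord_ge_mult[OF d(1) d(1) d(2) d(2)]] n(1) by simp
qed

lemma is_square_in_completion:
  assumes two: "\<one> \<oplus> \<one> \<noteq> \<zero>" "v (\<one> \<oplus> \<one>) = 0"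
    and u: "u \<in> carrier R" "u \<noteq> \<zero>" "v u = 0"
    and y: "y \<in> carrier R" "ord_ge 1 (u \<ominus> y \<otimes> y)"
  shows "is_square_in C (emb u)"
proof -
  define s where "s = rec_nat y (\<lambda>_ s. s \<ominus> (s \<otimes> s \<ominus> u) \<otimes> inv ((\<one> \<oplus> \<one>) \<otimes> s))"
  have s_Suc: "s (Suc n) = s n \<ominus> (s n \<otimes> s n \<ominus> u) \<otimes> inv ((\<one> \<oplus> \<one>) \<otimes> s n)" for n
    by (simp add: s_def)
  have inv: "s n \<in> carrier R \<and> s n \<noteq> \<zero> \<and> v (s n) = 0 \<and> ord_ge (int n + 1) (s n \<otimes> s n \<ominus> u)" for n
  proof (induction n)
    case 0
    have "y \<otimes> y \<ominus> u = \<ominus> (u \<ominus> y \<otimes> y)"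
      using u(1) y(1) by algebra
    then have "ord_ge 1 (y \<otimes> y \<ominus> u)"
      using ord_ge_minus[OF _ y(2)] u(1) y(1) by simp
    then show ?case
      using v_eq_zeroI_square_cong[OF u(1) y(1) u(2,3) y(2)] y(1) by (simp add: s_def)
  next
    case (Suc n)
    then show ?case
      using newton_step[OF two u(1) _ _ _ _ _ s_Suc[of n], of "int n + 1"] by (simp add: add.commute)
  qed
  have step: "ord_ge (int n + 1) (s (Suc n) \<ominus> s n)" for n
    using newton_step(4)[OF two u(1) _ _ _ _ _ s_Suc[of n], of "int n + 1"] inv[of n] by simp
  have sc: "s n \<in> carrier R" for n
    using inv by blast
  have far: "ord_ge (int n) (s (n + k) \<ominus> s n)" for n k
  proof (induction k)
    case 0
    then show ?case
      using sc[of n] by (simp add: a_minus_def r_neg)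
  next
    case (Suc k)
    have "s (n + Suc k) \<ominus> s n = (s (Suc (n + k)) \<ominus> s (n + k)) \<oplus> (s (n + k) \<ominus> s n)"
      unfolding add_Suc_right using sc[of n] sc[of "n + k"] sc[of "Suc (n + k)"] by algebra
    moreover have "ord_ge (int n) (s (Suc (n + k)) \<ominus> s (n + k))"
      using ord_ge_mono[OF step[of "n + k"], of "int n"] by simp
    ultimately show ?case
      using Suc.IH ord_ge_add sc by simp
  qed
  have "\<exists>M. \<forall>m\<ge>M. \<forall>n\<ge>M. ord_ge N (s m \<ominus> s n)" for N
  proof -
    have near: "ord_ge N (s m \<ominus> s (nat N))" if "m \<ge> nat N" for m
      using ord_ge_mono[OF far[of "nat N" "m - nat N"], of N] that by simp
    have "ord_ge N (s m \<ominus> s n)" if "m \<ge> nat N" "n \<ge> nat N" for m n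
    proof -
      have "s m \<ominus> s n = (s m \<ominus> s (nat N)) \<ominus> (s n \<ominus> s (nat N))"
        using sc[of m] sc[of n] sc[of "nat N"] by algebra
      then show ?thesis
        using ord_ge_diff[OF _ _ near[OF that(1)] near[OF that(2)]] sc by simp
    qed
    then show ?thesis by blast
  qed
  then have s: "s \<in> cauchy_seqs R v"
    using sc by (auto simp: cauchy_seqs_def)
  interpret c: ring_hom_ring CS C cls by (rule cls_hom)
  have "\<exists>M. \<forall>n\<ge>M. ord_ge N (s n \<otimes> s n \<ominus> u)" for N
  proof (intro exI allI impI)
    show "ord_ge N (s n \<otimes> s n \<ominus> u)" if "n \<ge> nat N" for n
    proof (rule ord_ge_mono)
      show "ord_ge (int n + 1) (s n \<otimes> s n \<ominus> u)"
        using inv by blast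
      show "N \<le> int n + 1"
        using that by linarith
    qed
  qed
  then have "cls (\<lambda>n. s n \<otimes> s n) = emb u"
    unfolding emb_eq using cls_eq_iff[OF cauchy_mult[OF s s] const_cauchy[OF u(1)]] by blast
  then have "emb u = cls s \<otimes>\<^bsub>C\<^esub> cls s"
    using c.hom_mult[of s s] s by simp
  then show ?thesis
    using c.hom_closed[of s] s by (auto simp: is_square_in_def)
qed

lemma even_value_if_square:
  assumes "a \<in> carrier R" "a \<noteq> \<zero>" "is_square_in C (emb a)"
  shows "even (v a)"
proof -
  obtain x where x: "x \<in> carrier C" "emb a = x \<otimes>\<^bsub>C\<^esub> x"
    using assms(3) unfolding is_square_in_def by blast
  obtain s where s: "s \<in> cauchy_seqs R v" "x = cls s"
    using cls_surj[OF x(1)] by blast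
  interpret c: ring_hom_ring CS C cls by (rule cls_hom)
  have "cls (\<lambda>_. a) = cls (\<lambda>n. s n \<otimes> s n)"
    using x s c.hom_mult[of s s] by (simp add: emb_eq)
  then have "\<forall>N. \<exists>M. \<forall>n\<ge>M. ord_ge N (a \<ominus> s n \<otimes> s n)"
    using cls_eq_iff[OF const_cauchy[OF assms(1)] cauchy_mult[OF s(1) s(1)]] by simp
  then obtain n where n: "ord_ge (v a + 1) (a \<ominus> s n \<otimes> s n)"
    by blast
  have "s n \<in> carrier R"
    using s cauchy_seqsD(1) by blast
  then have "s n \<otimes> s n \<noteq> \<zero>" "v (s n \<otimes> s n) = v a"
    using v_cong[OF assms(1) _ assms(2) n] by auto
  moreover from this have "s n \<noteq> \<zero>"
    by auto
  ultimately have "v a = 2 * v (s n)"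
    using v_square[of "s n"] \<open>s n \<in> carrier R\<close> by metis
  then show ?thesis
    by (rule dvdI)
qed

lemma minus_one_square_if_odd_sum_of_two_squares:
  assumes two: "\<one> \<oplus> \<one> \<noteq> \<zero>" "v (\<one> \<oplus> \<one>) = 0"
    and a: "a \<in> carrier R" "a \<noteq> \<zero>" "odd (v a)"
    and xy: "x \<in> carrier C" "y \<in> carrier C" "emb a = x \<otimes>\<^bsub>C\<^esub> x \<oplus>\<^bsub>C\<^esub> y \<otimes>\<^bsub>C\<^esub> y"
  shows "is_square_in C (emb (\<ominus> \<one>))"
proof -
  obtain s t where st: "s \<in> carrier R" "t \<in> carrier R" "ord_ge (v a + 1) (a \<ominus> (s \<otimes> s \<oplus> t \<otimes> t))"
    using sum_of_two_squares_approx[OF a(1) xy] by blast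
  define c where "c = s \<otimes> s \<oplus> t \<otimes> t"
  have c: "c \<in> carrier R" "c \<noteq> \<zero>" "v c = v a"
    using v_cong[OF a(1) _ a(2) st(3)] st by (auto simp: c_def)
  have dominated: "even (v (x \<otimes> x \<oplus> y \<otimes> y))"
    if "x \<in> carrier R" "y \<in> carrier R" "x \<noteq> \<zero>" "y = \<zero> \<or> v x < v y" for x y
  proof -
    have "ord_ge (v (x \<otimes> x) + 1) (y \<otimes> y)"
      using that v_square[of x] v_square[of y] by (cases "y = \<zero>") (auto simp: val_ge_def)
    then show ?thesis
      using v_add_eq(2)[of "x \<otimes> x" "y \<otimes> y"] that v_square[of x] nonzero_mult[of x x] by simp
  qed
  have c': "c = t \<otimes> t \<oplus> s \<otimes> s"
    using st by (simp add: c_def a_comm)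
  have odd: "odd (v c)"
    using c a by simp
  have nz: "s \<noteq> \<zero>" "t \<noteq> \<zero>"
  proof -
    show "t \<noteq> \<zero>"
    proof
      assume "t = \<zero>"
      then have "s \<noteq> \<zero>"
        using c st by (auto simp: c_def)
      then show False
        using dominated[of s t] odd st \<open>t = \<zero>\<close> by (simp add: c_def)
    qed
    then show "s \<noteq> \<zero>"
      using dominated[of t s] odd st c' by auto
  qed
  have vst: "v s = v t"
    using dominated[of t s] dominated[of s t] odd st nz c' by (metis c_def linorder_neqE)
  have it: "inv t \<in> carrier R" "t \<otimes> inv t = \<one>" "inv t \<noteq> \<zero>"
    using st nz by auto
  define r where "r = s \<otimes> inv t"
  have r: "r \<in> carrier R"
    using st it by (simp add: r_def)
  have "ord_ge (2 * v t) (s \<otimes> s)" "ord_ge (2 * v t) (t \<otimes> t)"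
    using v_square st nz vst by (auto simp: val_ge_def)
  then have "ord_ge (2 * v t) c"
    unfolding c_def using st by (intro ord_ge_add) auto
  then have "v c \<ge> 2 * v t"
    using c(2) by (simp add: val_ge_def)
  then have "v c \<ge> 2 * v t + 1"
    using odd by (metis dvd_triv_left order_le_imp_less_or_eq zless_imp_add1_zle)
  moreover have "v (c \<otimes> (inv t \<otimes> inv t)) = v c - 2 * v t"
    using c st nz it v_inv[of t] nonzero_mult[of "inv t" "inv t"] by (simp add: v_mult)
  ultimately have ge: "ord_ge 1 (c \<otimes> (inv t \<otimes> inv t))"
    by (simp add: val_ge_def)
  have "c \<otimes> (inv t \<otimes> inv t) = r \<otimes> r \<oplus> (t \<otimes> inv t) \<otimes> (t \<otimes> inv t)"
    unfolding c_def r_def using st(1,2) it(1) by algebra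
  then have "c \<otimes> (inv t \<otimes> inv t) = r \<otimes> r \<oplus> \<one>"
    using it by simp
  moreover have "\<ominus> \<one> \<ominus> r \<otimes> r = \<ominus> (r \<otimes> r \<oplus> \<one>)"
    using r by algebra
  ultimately have "ord_ge 1 (\<ominus> \<one> \<ominus> r \<otimes> r)"
    using ord_ge_minus[OF _ ge] c it r by simp
  then show ?thesis
    using is_square_in_completion[OF two _ _ _ r, of "\<ominus> \<one>"] by simp
qed

lemma unit_sum_of_two_squares:
  assumes two: "\<one> \<oplus> \<one> \<noteq> \<zero>" "v (\<one> \<oplus> \<one>) = 0"
    and gf: "global_field R" and u: "u \<in> carrier R" "u \<noteq> \<zero>" "v u = 0"
  shows "\<exists>x\<in>carrier C. \<exists>y\<in>carrier C. emb u = x \<otimes>\<^bsub>C\<^esub> x \<oplus>\<^bsub>C\<^esub> y \<otimes>\<^bsub>C\<^esub> y"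
proof -
  interpret e: ring_hom_cring R C emb by (rule emb_hom)
  have unit: ?thesis
    if yz: "y \<in> carrier R" "z \<in> carrier R" "y \<noteq> \<zero>" "v y = 0" "ord_ge 1 (u \<ominus> (y \<otimes> y \<oplus> z \<otimes> z))" for y z
  proof -
    define w where "w = u \<ominus> z \<otimes> z"
    have w: "w \<in> carrier R"
      using u yz by (simp add: w_def)
    have "y \<otimes> y \<ominus> w = \<ominus> (u \<ominus> (y \<otimes> y \<oplus> z \<otimes> z))" "w \<ominus> y \<otimes> y = u \<ominus> (y \<otimes> y \<oplus> z \<otimes> z)"
      unfolding w_def using yz(1,2) u(1) by algebra+
    then have ge: "ord_ge 1 (y \<otimes> y \<ominus> w)" "ord_ge 1 (w \<ominus> y \<otimes> y)"
      using yz u(1) ord_ge_minus[OF _ yz(5)] by simp_all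
    have "w \<noteq> \<zero>" "v w = 0"
      using v_cong[of "y \<otimes> y" w] ge(1) w yz v_square[of y] nonzero_mult[of y y] by simp_all
    then obtain x where x: "x \<in> carrier C" "emb w = x \<otimes>\<^bsub>C\<^esub> x"
      using is_square_in_completion[OF two w _ _ yz(1) ge(2)] by (auto simp: is_square_in_def)
    have "u = w \<oplus> z \<otimes> z"
      unfolding w_def using u(1) yz(2) by algebra
    then have "emb u = x \<otimes>\<^bsub>C\<^esub> x \<oplus>\<^bsub>C\<^esub> emb z \<otimes>\<^bsub>C\<^esub> emb z"
      using e.hom_add[of w "z \<otimes> z"] w yz(2) x by simp
    then show ?thesis
      using x(1) e.hom_closed[OF yz(2)] by blast
  qed
  obtain y z where yz: "y \<in> carrier R" "z \<in> carrier R" "ord_ge 0 y" "ord_ge 0 z"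
    "ord_ge 1 (u \<ominus> (y \<otimes> y \<oplus> z \<otimes> z))"
    using global_field_sum_of_two_squares_mod[OF gf u(1)] u(3) by (auto simp: val_ge_def)
  have yz': "ord_ge 1 (u \<ominus> (z \<otimes> z \<oplus> y \<otimes> y))"
    using yz by (simp add: a_comm)
  have "\<not> (ord_ge 1 y \<and> ord_ge 1 z)"
  proof
    assume "ord_ge 1 y \<and> ord_ge 1 z"
    then have "ord_ge 1 (y \<otimes> y)" "ord_ge 1 (z \<otimes> z)"
      using yz(1-4) by (simp_all add: ord_ge_mult0)
    then have "ord_ge 1 (y \<otimes> y \<oplus> z \<otimes> z)"
      using yz(1,2) by (simp add: ord_ge_add)
    then have "ord_ge 1 ((u \<ominus> (y \<otimes> y \<oplus> z \<otimes> z)) \<oplus> (y \<otimes> y \<oplus> z \<otimes> z))"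
      using yz u(1) by (simp add: ord_ge_add)
    moreover have "(u \<ominus> (y \<otimes> y \<oplus> z \<otimes> z)) \<oplus> (y \<otimes> y \<oplus> z \<otimes> z) = u"
      using yz(1,2) u(1) by algebra
    ultimately show False
      using u by (simp add: val_ge_def)
  qed
  then consider "y \<noteq> \<zero>" "v y = 0" | "z \<noteq> \<zero>" "v z = 0"
    using yz(3,4) by (force simp: val_ge_def)
  then show ?thesis
  proof cases
    case 1
    then show ?thesis
      using unit[OF yz(1,2) _ _ yz(5)] by blast
  next
    case 2
    then show ?thesis
      using unit[OF yz(2,1) _ _ yz'] by blast
  qed
qed

lemma even_value_sum_of_two_squares:
  assumes two: "\<one> \<oplus> \<one> \<noteq> \<zero>" "v (\<one> \<oplus> \<one>) = 0"
    and gf: "global_field R" and a: "a \<in> carrier R" "a \<noteq> \<zero>" "even (v a)"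
  shows "\<exists>x\<in>carrier C. \<exists>y\<in>carrier C. emb a = x \<otimes>\<^bsub>C\<^esub> x \<oplus>\<^bsub>C\<^esub> y \<otimes>\<^bsub>C\<^esub> y"
proof -
  interpret e: ring_hom_cring R C emb by (rule emb_hom)
  obtain m where m: "v a = 2 * m"
    using a(3) by blast
  obtain b where b: "b \<in> carrier R" "b \<noteq> \<zero>" "v b = m"
    using v_surj by blast
  define i where "i = inv b"
  have i: "i \<in> carrier R" "i \<noteq> \<zero>" "b \<otimes> i = \<one>" "v i = - m"
    using b v_inv[of b] by (auto simp: i_def)
  define u where "u = a \<otimes> (i \<otimes> i)"
  have u: "u \<in> carrier R" "u \<noteq> \<zero>" "v u = 0"
    using a i m nonzero_mult by (auto simp: u_def v_mult)
  obtain x y where xy: "x \<in> carrier C" "y \<in> carrier C" "emb u = x \<otimes>\<^bsub>C\<^esub> x \<oplus>\<^bsub>C\<^esub> y \<otimes>\<^bsub>C\<^esub> y"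
    using unit_sum_of_two_squares[OF two gf u] by blast
  have "(b \<otimes> b) \<otimes> u = a \<otimes> ((b \<otimes> i) \<otimes> (b \<otimes> i))"
    unfolding u_def using a(1) b(1) i(1) by algebra
  then have "a = (b \<otimes> b) \<otimes> u"
    using i a by simp
  then have "emb a = (emb b \<otimes>\<^bsub>C\<^esub> emb b) \<otimes>\<^bsub>C\<^esub> emb u"
    using e.hom_mult[of "b \<otimes> b" u] b u by simp
  also have "\<dots> = (emb b \<otimes>\<^bsub>C\<^esub> x) \<otimes>\<^bsub>C\<^esub> (emb b \<otimes>\<^bsub>C\<^esub> x) \<oplus>\<^bsub>C\<^esub> (emb b \<otimes>\<^bsub>C\<^esub> y) \<otimes>\<^bsub>C\<^esub> (emb b \<otimes>\<^bsub>C\<^esub> y)"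
    unfolding xy(3) using xy(1,2) e.hom_closed[OF b(1)] by (simp add: e.S.r_distr e.S.m_ac)
  finally show ?thesis
    using xy e.hom_closed[OF b(1)] by (metis e.S.m_closed)
qed

lemma emb_eq_diff_of_squares:
  assumes two: "\<one> \<oplus> \<one> \<noteq> \<zero>" and a: "a \<in> carrier R"
  shows "\<exists>p\<in>carrier C. \<exists>q\<in>carrier C. emb a = p \<otimes>\<^bsub>C\<^esub> p \<oplus>\<^bsub>C\<^esub> emb (\<ominus> \<one>) \<otimes>\<^bsub>C\<^esub> (q \<otimes>\<^bsub>C\<^esub> q)"
proof -
  interpret e: ring_hom_cring R C emb by (rule emb_hom)
  define i where "i = inv (\<one> \<oplus> \<one>)"
  have i: "i \<in> carrier R" "(\<one> \<oplus> \<one>) \<otimes> i = \<one>"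
    using two by (auto simp: i_def)
  define p q where "p = (a \<oplus> \<one>) \<otimes> i" and "q = (a \<ominus> \<one>) \<otimes> i"
  have pq: "p \<in> carrier R" "q \<in> carrier R"
    using a i by (auto simp: p_def q_def)
  have "p \<otimes> p \<oplus> \<ominus> \<one> \<otimes> (q \<otimes> q) = a \<otimes> (((\<one> \<oplus> \<one>) \<otimes> i) \<otimes> ((\<one> \<oplus> \<one>) \<otimes> i))"
    unfolding p_def q_def using a i(1) by algebra
  also have "\<dots> = a"
    using a i by simp
  finally have "emb a = emb (p \<otimes> p \<oplus> \<ominus> \<one> \<otimes> (q \<otimes> q))" by simp
  also have "\<dots> = emb p \<otimes>\<^bsub>C\<^esub> emb p \<oplus>\<^bsub>C\<^esub> emb (\<ominus> \<one>) \<otimes>\<^bsub>C\<^esub> (emb q \<otimes>\<^bsub>C\<^esub> emb q)"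
    using pq by (simp del: e.hom_a_inv)
  finally show ?thesis
    using e.hom_closed pq by blast
qed

theorem local_length_cases:
  assumes two: "\<one> \<oplus> \<one> \<noteq> \<zero>" "v (\<one> \<oplus> \<one>) = 0"
    and gf: "global_field R" and a: "a \<in> carrier R" "a \<noteq> \<zero>"
  shows "odd (v a) \<Longrightarrow> is_square_in C (\<ominus>\<^bsub>C\<^esub> \<one>\<^bsub>C\<^esub>) \<Longrightarrow> local_length R v a = 2"
    and "odd (v a) \<Longrightarrow> \<not> is_square_in C (\<ominus>\<^bsub>C\<^esub> \<one>\<^bsub>C\<^esub>) \<Longrightarrow> local_length R v a = 3"
    and "is_square_in C (emb a) \<Longrightarrow> local_length R v a = 1"
    and "even (v a) \<Longrightarrow> \<not> is_square_in C (emb a) \<Longrightarrow> local_length R v a = 2"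
proof -
  interpret e: ring_hom_cring R C emb by (rule emb_hom)
  have m1: "emb (\<ominus> \<one>) = \<ominus>\<^bsub>C\<^esub> \<one>\<^bsub>C\<^esub>"
    by simp
  have not0: "\<not> sum_of_squares_in C 0 (emb a)"
    using emb_eq_zero_iff a by simp
  obtain p q where pq: "p \<in> carrier C" "q \<in> carrier C"
    "emb a = p \<otimes>\<^bsub>C\<^esub> p \<oplus>\<^bsub>C\<^esub> emb (\<ominus> \<one>) \<otimes>\<^bsub>C\<^esub> (q \<otimes>\<^bsub>C\<^esub> q)"
    using emb_eq_diff_of_squares[OF two(1) a(1)] by blast
  have len2: "local_length R v a = 2"
    if "\<not> is_square_in C (emb a)" "x \<in> carrier C" "y \<in> carrier C"
      "emb a = x \<otimes>\<^bsub>C\<^esub> x \<oplus>\<^bsub>C\<^esub> y \<otimes>\<^bsub>C\<^esub> y" for x y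
  proof -
    have "sum_of_squares_in C (Suc (Suc 0)) (emb a)"
      unfolding e.S.sum_of_squares_in_2 using that by blast
    moreover have "\<not> sum_of_squares_in C m (emb a)" if "m < Suc (Suc 0)" for m
      using that not0 \<open>\<not> is_square_in C (emb a)\<close> by (auto simp: less_Suc_eq e.S.sum_of_squares_in_1)
    ultimately have "local_length R v a = enat (Suc (Suc 0))"
      unfolding local_length_def by (rule square_length_eqI)
    then show ?thesis
      by (simp add: numeral_eq_enat numeral_2_eq_2)
  qed
  show "local_length R v a = 1" if "is_square_in C (emb a)"
  proof -
    have "local_length R v a = enat (Suc 0)"
      unfolding local_length_def using that not0
      by (intro square_length_eqI) (auto simp: e.S.sum_of_squares_in_1)
    then show ?thesis
      by (simp add: one_enat_def)
  qed
  show "local_length R v a = 2" if "even (v a)" "\<not> is_square_in C (emb a)"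
    using even_value_sum_of_two_squares[OF two gf a that(1)] len2[OF that(2)] by blast
  assume odd: "odd (v a)"
  then have nsq: "\<not> is_square_in C (emb a)"
    using even_value_if_square a by blast
  show "local_length R v a = 2" if sq: "is_square_in C (\<ominus>\<^bsub>C\<^esub> \<one>\<^bsub>C\<^esub>)"
  proof -
    obtain i where i: "i \<in> carrier C" "emb (\<ominus> \<one>) = i \<otimes>\<^bsub>C\<^esub> i"
      using sq unfolding is_square_in_def m1 by blast
    have "emb a = p \<otimes>\<^bsub>C\<^esub> p \<oplus>\<^bsub>C\<^esub> (i \<otimes>\<^bsub>C\<^esub> q) \<otimes>\<^bsub>C\<^esub> (i \<otimes>\<^bsub>C\<^esub> q)"
      unfolding pq(3) i(2) using pq(1,2) i(1) by (simp add: e.S.m_ac)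
    then show ?thesis
      using len2[OF nsq pq(1) _] i pq by (metis e.S.m_closed)
  qed
  show "local_length R v a = 3" if nm1: "\<not> is_square_in C (\<ominus>\<^bsub>C\<^esub> \<one>\<^bsub>C\<^esub>)"
  proof -
    obtain x y where xy: "x \<in> carrier C" "y \<in> carrier C"
      "emb (\<ominus> \<one>) = x \<otimes>\<^bsub>C\<^esub> x \<oplus>\<^bsub>C\<^esub> y \<otimes>\<^bsub>C\<^esub> y"
      using unit_sum_of_two_squares[OF two gf, of "\<ominus> \<one>"] by auto
    have "emb a = p \<otimes>\<^bsub>C\<^esub> p \<oplus>\<^bsub>C\<^esub>
        ((x \<otimes>\<^bsub>C\<^esub> q) \<otimes>\<^bsub>C\<^esub> (x \<otimes>\<^bsub>C\<^esub> q) \<oplus>\<^bsub>C\<^esub> (y \<otimes>\<^bsub>C\<^esub> q) \<otimes>\<^bsub>C\<^esub> (y \<otimes>\<^bsub>C\<^esub> q))"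
      unfolding pq(3) xy(3) using pq(1,2) xy(1,2) by (simp add: e.S.l_distr e.S.r_distr e.S.m_ac)
    moreover have "sum_of_squares_in C (Suc (Suc 0))
        ((x \<otimes>\<^bsub>C\<^esub> q) \<otimes>\<^bsub>C\<^esub> (x \<otimes>\<^bsub>C\<^esub> q) \<oplus>\<^bsub>C\<^esub> (y \<otimes>\<^bsub>C\<^esub> q) \<otimes>\<^bsub>C\<^esub> (y \<otimes>\<^bsub>C\<^esub> q))"
      unfolding e.S.sum_of_squares_in_2 using xy pq by blast
    ultimately have "sum_of_squares_in C (Suc (Suc (Suc 0))) (emb a)"
      using pq(1) e.S.sum_of_squares_in_Suc by blast
    moreover have "\<not> sum_of_squares_in C (Suc (Suc 0)) (emb a)"
      using minus_one_square_if_odd_sum_of_two_squares[OF two a odd] nm1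
      unfolding e.S.sum_of_squares_in_2 m1 by metis
    then have "\<not> sum_of_squares_in C m (emb a)" if "m < Suc (Suc (Suc 0))" for m
      using that not0 nsq by (auto simp: less_Suc_eq e.S.sum_of_squares_in_1)
    ultimately have "local_length R v a = enat (Suc (Suc (Suc 0)))"
      unfolding local_length_def by (rule square_length_eqI)
    then show ?thesis
      by (simp add: numeral_eq_enat numeral_3_eq_3)
  qed
qed

end

theorem mainTheorem1:
  fixes K :: "('a, 'b) ring_scheme" and v :: "'a \<Rightarrow> int" and a :: 'a
  assumes "global_field K"
    and "\<one>\<^bsub>K\<^esub> \<oplus>\<^bsub>K\<^esub> \<one>\<^bsub>K\<^esub> \<noteq> \<zero>\<^bsub>K\<^esub>"
    and "finite_place K v" and "\<not> dyadic K v"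
    and "a \<in> carrier K" and "a \<noteq> \<zero>\<^bsub>K\<^esub>"
  shows "(odd (v a) \<and> is_square_in (completion K v) (\<ominus>\<^bsub>completion K v\<^esub> \<one>\<^bsub>completion K v\<^esub>)
            \<longrightarrow> local_length K v a = 2) \<and>
         (odd (v a) \<and> \<not> is_square_in (completion K v) (\<ominus>\<^bsub>completion K v\<^esub> \<one>\<^bsub>completion K v\<^esub>)
            \<longrightarrow> local_length K v a = 3) \<and>
         (even (v a) \<and> is_square_in (completion K v) (to_completion K v a)
            \<longrightarrow> local_length K v a = 1) \<and>
         (even (v a) \<and> \<not> is_square_in (completion K v) (to_completion K v a)
            \<longrightarrow> local_length K v a = 2)"
proof -
  interpret field K
    using assms(1) unfolding global_field_def number_field_def global_function_field_def by blast
  interpret discrete_valuation K v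
    by unfold_locales (rule assms(3))
  have "ord_ge 0 (\<one>\<^bsub>K\<^esub> \<oplus>\<^bsub>K\<^esub> \<one>\<^bsub>K\<^esub>)"
    by (intro ord_ge_add) auto
  then have two: "v (\<one>\<^bsub>K\<^esub> \<oplus>\<^bsub>K\<^esub> \<one>\<^bsub>K\<^esub>) = 0"
    using assms(2,4) by (simp add: val_ge_def dyadic_def)
  show ?thesis
    using local_length_cases[OF assms(2) two assms(1,5,6)] by blast
qed

end
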